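(* Let $\mu_d,\varepsilon_d,\xi_d,\zeta_d\in\mathbb{C}^{3n\times3n}$ satisfy: $\mu_d$ is Hermitian positive definite, $\Phi\equiv\varepsilon_d-\xi_d\mu_d^{-1}\zeta_d$ is Hermitian positive definite, and $\xi_d^{*}=\zeta_d$. Then the generalized eigenvalue problem $$\begin{bmatrix}C&0\\ 0&C^{*}\end{bmatrix}\begin{bmatrix}E\\ H\end{bmatrix}=\omega\left(\imath\begin{bmatrix}\zeta_d&\mu_d\\ -\varepsilon_d&-\xi_d\end{bmatrix}\right)\begin{bmatrix}E\\ H\end{bmatrix}$$ can be reduced to the null space free generalized eigenvalue problem $$\left(\imath\begin{bmatrix}0&\Sigma_r^{-1}\\ -\Sigma_r^{-1}&0\end{bmatrix}\right)y_r=\omega^{-1}A_r\,y_r,\qquad y_r\in\mathbb{C}^{4n},$$ that is, the nonzero eigenvalues $\omega$ of the first problem are exactly the numbers $\omega\neq0$ for which the second problem has a nonzero solution $y_r$; here $$A_r\equiv\mathrm{diag}(P_r^{*},Q_r^{*})\begin{bmatrix}\mu_d^{-1}\zeta_d&-I_{3n}\\ I_{3n}&0\end{bmatrix}\begin{bmatrix}\Phi^{-1}&0\\ 0&\mu_d^{-1}\end{bmatrix}\begin{bmatrix}\xi_d\mu_d^{-1}&I_{3n}\\ -I_{3n}&0\end{bmatrix}\mathrm{diag}(P_r,Q_r)$$ is Hermitian and positive definite.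
   Context: Notation: $\imath=\sqrt{-1}$, $I_m$ is the $m\times m$ identity, $\otimes$ is the Kronecker product, $^{*}$ is the conjugate transpose, and $\mathrm{diag}(X,Y)$ is the block diagonal matrix (blocks may be rectangular). An eigenvalue is a number $\omega\in\mathbb{C}$ for which the equation has a nonzero solution. Grid: $n_1,n_2,n_3\ge 2$ are integers, $n=n_1n_2n_3$; $\delta_x,\delta_y,\delta_z>0$ are mesh lengths; $a>0$ is the lattice constant, $\mathbf{a}_\ell=a\,e_\ell$ with $e_\ell$ the $\ell$-th unit vector of $\mathbb{R}^3$ ($\ell=1,2,3$). Standing assumption: $\mathbf{k}=(k_1,k_2,k_3)^{\top}\in\mathbb{R}^3$ is nonzero with $0\le k_1,k_2,k_3\le\frac1{2a}$. Discrete curl: for a vector $\mathbf{a}\in\mathbb{R}^3$ and integer $m\ge 2$, $K_{\mathbf{a},m}\in\mathbb{C}^{m\times m}$ has $-1$ on the diagonal, $1$ on the first superdiagonal, $e^{\imath 2\pi\mathbf{k}\cdot\mathbf{a}}$ in position $(m,1)$, and zeros elsewhere. Put $$C_1=\delta_x^{-1}(I_{n_3}\otimes I_{n_2}\otimes K_{\mathbf{a}_1,n_1}),\quad C_2=\delta_y^{-1}(I_{n_3}\otimes K_{\mathbf{a}_2,n_2}\otimes I_{n_1}),\quad C_3=\delta_z^{-1}(K_{\mathbf{a}_3,n_3}\otimes I_{n_2}\otimes I_{n_1}),$$ $$C=\begin{bmatrix}0&-C_3&C_2\\ C_3&0&-C_1\\ -C_2&C_1&0\end{bmatrix}\in\mathbb{C}^{3n\times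 3n}.$$ Diagonalizing matrices: $\theta_{m,i}=\frac{\imath 2\pi i}{m}$, $\theta_{\mathbf{a},m}=\frac{\imath 2\pi\mathbf{k}\cdot\mathbf{a}}{m}$, $D_{\mathbf{a},m}=\mathrm{diag}(1,e^{\theta_{\mathbf{a},m}},\dots,e^{(m-1)\theta_{\mathbf{a},m}})$, $U_m\in\mathbb{C}^{m\times m}$ is the matrix with columns $(1,e^{\theta_{m,i}},\dots,e^{(m-1)\theta_{m,i}})^{\top}$, $i=0,\dots,m-1$, and $\Lambda_{\mathbf{a},m}=\mathrm{diag}(e^{\theta_{m,0}+\theta_{\mathbf{a},m}}-1,\dots,e^{\theta_{m,m-1}+\theta_{\mathbf{a},m}}-1)$. Set $$T=\tfrac{1}{\sqrt n}(D_{\mathbf{a}_3,n_3}\otimes D_{\mathbf{a}_2,n_2}\otimes D_{\mathbf{a}_1,n_1})(U_{n_3}\otimes U_{n_2}\otimes U_{n_1}),$$ $$\Lambda_1=\delta_x^{-1}(I_{n_3}\otimes I_{n_2}\otimes\Lambda_{\mathbf{a}_1,n_1}),\quad \Lambda_2=\delta_y^{-1}(I_{n_3}\otimes\Lambda_{\mathbf{a}_2,n_2}\otimes I_{n_1}),\quad \Lambda_3=\delta_z^{-1}(\Lambda_{\mathbf{a}_3,n_3}\otimes I_{n_2}\otimes I_{n_1}).$$ Let $\alpha,\beta$ be nonzero real numbers with $\alpha\delta_x\ne\beta\delta_y$ and $\delta_z\ne\beta\delta_y$, and let $$\Lambda_q=\Lambda_1^{*}\Lambda_1+\Lambda_2^{*}\Lambda_2+\Lambda_3^{*}\Lambda_3,\quad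 \Lambda_p=\begin{bmatrix}\beta\Lambda_3-\Lambda_2\\ \Lambda_1-\alpha\Lambda_3\\ \alpha\Lambda_2-\beta\Lambda_1\end{bmatrix},\quad T_1=\begin{bmatrix}\alpha T\\ \beta T\\ T\end{bmatrix}.$$ (The diagonal matrices $\Lambda_q$ and $\Lambda_p^{*}\Lambda_p$ are positive definite.) With $\Pi_0=\begin{bmatrix}\Lambda_1\\ \Lambda_2\\ \Lambda_3\end{bmatrix}\Lambda_q^{-1/2}$ and $\overline{\Pi_0}$ its entrywise conjugate, define the $3n\times n$ matrices $$Q_0=(I_3\otimes T)\Pi_0,\quad P_0=(I_3\otimes T)\overline{\Pi_0},$$ $$Q_1=(I-Q_0Q_0^{*})T_1(\Lambda_p^{*}\Lambda_p\Lambda_q^{-1})^{-1/2},\quad P_1=(I-P_0P_0^{*})T_1(\Lambda_p^{*}\Lambda_p\Lambda_q^{-1})^{-1/2},$$ $$Q_2=C^{*}T_1(\Lambda_p^{*}\Lambda_p)^{-1/2},\quad P_2=CT_1(\Lambda_p^{*}\Lambda_p)^{-1/2},$$ and $P_r=[P_2,\,P_1]$, $Q_r=[Q_1,\,Q_2]\in\mathbb{C}^{3n\times 2n}$, $\Sigma_r=\mathrm{diag}(\Lambda_q^{1/2},\Lambda_q^{1/2})\in\mathbb{R}^{2n\times 2n}$. *)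

theory Defs
  imports
    Complex_Main
    "Jordan_Normal_Form.Gauss_Jordan_Elimination"
    "Jordan_Normal_Form.Schur_Decomposition"
    "Jordan_Normal_Form.Matrix_Kernel"
begin

section \<open>Matrix notions\<close>

definition kronecker :: "complex mat \<Rightarrow> complex mat \<Rightarrow> complex mat" (infixr \<open>\<otimes>\<^sub>k\<close> 75) where
  "A \<otimes>\<^sub>k B = mat (dim_row A * dim_row B) (dim_col A * dim_col B)
     (\<lambda>(i, j). A $$ (i div dim_row B, j div dim_col B) * B $$ (i mod dim_row B, j mod dim_col B))"

definition append_cols :: "complex mat \<Rightarrow> complex mat \<Rightarrow> complex mat" (infixr \<open>@\<^sub>c\<close> 66) where
  "A @\<^sub>c B = four_block_mat A B (0\<^sub>m 0 (dim_col A)) (0\<^sub>m 0 (dim_col B))"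

text \<open>The inverse is unspecified for a singular argument; every matrix that is inverted
  below is invertible.\<close>

definition mat_inv :: "complex mat \<Rightarrow> complex mat" where
  "mat_inv A = the (mat_inverse A)"

text \<open>Real power of a diagonal positive definite matrix, such as its square root
  (\<open>s = 1/2\<close>). The diagonal entries of such a matrix are positive reals, so that \<open>Re\<close>
  only changes their type.\<close>

definition diag_powr :: "complex mat \<Rightarrow> real \<Rightarrow> complex mat" where
  "diag_powr A s = mat_diag (dim_row A) (\<lambda>i. complex_of_real (Re (A $$ (i, i)) powr s))"

definition hermitian :: "complex mat \<Rightarrow> bool" where
  "hermitian A \<longleftrightarrow> mat_adjoint A = A"

text \<open>\<open>(A *\<^sub>v v) \<bullet>c v\<close> is the number \<open>v\<^sup>* A v\<close>.\<close>

definition positive_definite :: "complex mat \<Rightarrow> bool" where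
  "positive_definite A \<longleftrightarrow> dim_row A = dim_col A \<and>
     (\<forall>v \<in> carrier_vec (dim_col A). v \<noteq> 0\<^sub>v (dim_col A) \<longrightarrow>
        (A *\<^sub>v v) \<bullet>c v \<in> \<real> \<and> Re ((A *\<^sub>v v) \<bullet>c v) > 0)"

definition gen_eigenvalue :: "nat \<Rightarrow> complex mat \<Rightarrow> complex mat \<Rightarrow> complex \<Rightarrow> bool" where
  "gen_eigenvalue N L M \<omega> \<longleftrightarrow>
     (\<exists>x \<in> carrier_vec N. x \<noteq> 0\<^sub>v N \<and> L *\<^sub>v x = \<omega> \<cdot>\<^sub>v (M *\<^sub>v x))"


section \<open>The grid and the discrete curl\<close>

text \<open>Numbers of grid points, mesh lengths, lattice constant, and wave vector (of dimension 3).\<close>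

record grid =
  n\<^sub>1 :: nat
  n\<^sub>2 :: nat
  n\<^sub>3 :: nat
  \<delta>\<^sub>x :: real
  \<delta>\<^sub>y :: real
  \<delta>\<^sub>z :: real
  lattice_const :: real
  wave :: "real vec"

definition size_grid :: "grid \<Rightarrow> nat" where
  "size_grid G = n\<^sub>1 G * n\<^sub>2 G * n\<^sub>3 G"

text \<open>The lattice vectors \<open>a e\<^sub>1\<close>, \<open>a e\<^sub>2\<close>, \<open>a e\<^sub>3\<close>; \<open>unit_vec\<close> counts from 0.\<close>

definition a\<^sub>1 :: "grid \<Rightarrow> real vec" where "a\<^sub>1 G = lattice_const G \<cdot>\<^sub>v unit_vec 3 0"
definition a\<^sub>2 :: "grid \<Rightarrow> real vec" where "a\<^sub>2 G = lattice_const G \<cdot>\<^sub>v unit_vec 3 1"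
definition a\<^sub>3 :: "grid \<Rightarrow> real vec" where "a\<^sub>3 G = lattice_const G \<cdot>\<^sub>v unit_vec 3 2"

definition K_mat :: "grid \<Rightarrow> real vec \<Rightarrow> nat \<Rightarrow> complex mat" where
  "K_mat G v m = mat m m (\<lambda>(i, j).
     if i = j then -1
     else if j = i + 1 then 1
     else if i = m - 1 \<and> j = 0 then exp (\<i> * 2 * complex_of_real pi * complex_of_real (wave G \<bullet> v))
     else 0)"

definition C\<^sub>1 :: "grid \<Rightarrow> complex mat" where
  "C\<^sub>1 G = complex_of_real (inverse (\<delta>\<^sub>x G)) \<cdot>\<^sub>m (1\<^sub>m (n\<^sub>3 G) \<otimes>\<^sub>k 1\<^sub>m (n\<^sub>2 G) \<otimes>\<^sub>k K_mat G (a\<^sub>1 G) (n\<^sub>1 G))"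

definition C\<^sub>2 :: "grid \<Rightarrow> complex mat" where
  "C\<^sub>2 G = complex_of_real (inverse (\<delta>\<^sub>y G)) \<cdot>\<^sub>m (1\<^sub>m (n\<^sub>3 G) \<otimes>\<^sub>k K_mat G (a\<^sub>2 G) (n\<^sub>2 G) \<otimes>\<^sub>k 1\<^sub>m (n\<^sub>1 G))"

definition C\<^sub>3 :: "grid \<Rightarrow> complex mat" where
  "C\<^sub>3 G = complex_of_real (inverse (\<delta>\<^sub>z G)) \<cdot>\<^sub>m (K_mat G (a\<^sub>3 G) (n\<^sub>3 G) \<otimes>\<^sub>k 1\<^sub>m (n\<^sub>2 G) \<otimes>\<^sub>k 1\<^sub>m (n\<^sub>1 G))"

definition curl :: "grid \<Rightarrow> complex mat" where
  "curl G = (let Z = 0\<^sub>m (size_grid G) (size_grid G) in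
      (Z         @\<^sub>c (- C\<^sub>3 G) @\<^sub>c C\<^sub>2 G)
   @\<^sub>r (C\<^sub>3 G     @\<^sub>c Z         @\<^sub>c (- C\<^sub>1 G))
   @\<^sub>r ((- C\<^sub>2 G) @\<^sub>c C\<^sub>1 G     @\<^sub>c Z))"


section \<open>Diagonalization\<close>

definition \<theta>_idx :: "nat \<Rightarrow> nat \<Rightarrow> complex" where
  "\<theta>_idx m i = \<i> * 2 * complex_of_real pi * of_nat i / of_nat m"

definition \<theta>_vec :: "grid \<Rightarrow> real vec \<Rightarrow> nat \<Rightarrow> complex" where
  "\<theta>_vec G v m = \<i> * 2 * complex_of_real pi * complex_of_real (wave G \<bullet> v) / of_nat m"

definition D_mat :: "grid \<Rightarrow> real vec \<Rightarrow> nat \<Rightarrow> complex mat" where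
  "D_mat G v m = mat_diag m (\<lambda>j. exp (of_nat j * \<theta>_vec G v m))"

definition U_mat :: "nat \<Rightarrow> complex mat" where
  "U_mat m = mat m m (\<lambda>(j, i). exp (of_nat j * \<theta>_idx m i))"

definition \<Lambda>_mat :: "grid \<Rightarrow> real vec \<Rightarrow> nat \<Rightarrow> complex mat" where
  "\<Lambda>_mat G v m = mat_diag m (\<lambda>i. exp (\<theta>_idx m i + \<theta>_vec G v m) - 1)"

definition T_mat :: "grid \<Rightarrow> complex mat" where
  "T_mat G = complex_of_real (1 / sqrt (real (size_grid G))) \<cdot>\<^sub>m
     ((D_mat G (a\<^sub>3 G) (n\<^sub>3 G) \<otimes>\<^sub>k D_mat G (a\<^sub>2 G) (n\<^sub>2 G) \<otimes>\<^sub>k D_mat G (a\<^sub>1 G) (n\<^sub>1 G)) *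
      (U_mat (n\<^sub>3 G) \<otimes>\<^sub>k U_mat (n\<^sub>2 G) \<otimes>\<^sub>k U_mat (n\<^sub>1 G)))"

definition \<Lambda>\<^sub>1 :: "grid \<Rightarrow> complex mat" where
  "\<Lambda>\<^sub>1 G = complex_of_real (inverse (\<delta>\<^sub>x G)) \<cdot>\<^sub>m (1\<^sub>m (n\<^sub>3 G) \<otimes>\<^sub>k 1\<^sub>m (n\<^sub>2 G) \<otimes>\<^sub>k \<Lambda>_mat G (a\<^sub>1 G) (n\<^sub>1 G))"

definition \<Lambda>\<^sub>2 :: "grid \<Rightarrow> complex mat" where
  "\<Lambda>\<^sub>2 G = complex_of_real (inverse (\<delta>\<^sub>y G)) \<cdot>\<^sub>m (1\<^sub>m (n\<^sub>3 G) \<otimes>\<^sub>k \<Lambda>_mat G (a\<^sub>2 G) (n\<^sub>2 G) \<otimes>\<^sub>k 1\<^sub>m (n\<^sub>1 G))"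

definition \<Lambda>\<^sub>3 :: "grid \<Rightarrow> complex mat" where
  "\<Lambda>\<^sub>3 G = complex_of_real (inverse (\<delta>\<^sub>z G)) \<cdot>\<^sub>m (\<Lambda>_mat G (a\<^sub>3 G) (n\<^sub>3 G) \<otimes>\<^sub>k 1\<^sub>m (n\<^sub>2 G) \<otimes>\<^sub>k 1\<^sub>m (n\<^sub>1 G))"

definition \<Lambda>\<^sub>q :: "grid \<Rightarrow> complex mat" where
  "\<Lambda>\<^sub>q G = mat_adjoint (\<Lambda>\<^sub>1 G) * \<Lambda>\<^sub>1 G + mat_adjoint (\<Lambda>\<^sub>2 G) * \<Lambda>\<^sub>2 G + mat_adjoint (\<Lambda>\<^sub>3 G) * \<Lambda>\<^sub>3 G"

definition \<Lambda>\<^sub>p :: "grid \<Rightarrow> real \<Rightarrow> real \<Rightarrow> complex mat" where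
  "\<Lambda>\<^sub>p G \<alpha> \<beta> =
      (complex_of_real \<beta> \<cdot>\<^sub>m \<Lambda>\<^sub>3 G - \<Lambda>\<^sub>2 G)
   @\<^sub>r (\<Lambda>\<^sub>1 G - complex_of_real \<alpha> \<cdot>\<^sub>m \<Lambda>\<^sub>3 G)
   @\<^sub>r (complex_of_real \<alpha> \<cdot>\<^sub>m \<Lambda>\<^sub>2 G - complex_of_real \<beta> \<cdot>\<^sub>m \<Lambda>\<^sub>1 G)"

definition T\<^sub>1 :: "grid \<Rightarrow> real \<Rightarrow> real \<Rightarrow> complex mat" where
  "T\<^sub>1 G \<alpha> \<beta> = (complex_of_real \<alpha> \<cdot>\<^sub>m T_mat G) @\<^sub>r (complex_of_real \<beta> \<cdot>\<^sub>m T_mat G) @\<^sub>r T_mat G"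

definition \<Pi>\<^sub>0 :: "grid \<Rightarrow> complex mat" where
  "\<Pi>\<^sub>0 G = (\<Lambda>\<^sub>1 G @\<^sub>r \<Lambda>\<^sub>2 G @\<^sub>r \<Lambda>\<^sub>3 G) * diag_powr (\<Lambda>\<^sub>q G) (- 1/2)"


section \<open>Singular vectors\<close>

definition Q\<^sub>0 :: "grid \<Rightarrow> complex mat" where
  "Q\<^sub>0 G = (1\<^sub>m 3 \<otimes>\<^sub>k T_mat G) * \<Pi>\<^sub>0 G"

definition P\<^sub>0 :: "grid \<Rightarrow> complex mat" where
  "P\<^sub>0 G = (1\<^sub>m 3 \<otimes>\<^sub>k T_mat G) * map_mat cnj (\<Pi>\<^sub>0 G)"

definition \<Lambda>\<^sub>p\<^sub>p :: "grid \<Rightarrow> real \<Rightarrow> real \<Rightarrow> complex mat" where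
  "\<Lambda>\<^sub>p\<^sub>p G \<alpha> \<beta> = mat_adjoint (\<Lambda>\<^sub>p G \<alpha> \<beta>) * \<Lambda>\<^sub>p G \<alpha> \<beta>"

definition Q\<^sub>1 :: "grid \<Rightarrow> real \<Rightarrow> real \<Rightarrow> complex mat" where
  "Q\<^sub>1 G \<alpha> \<beta> = (1\<^sub>m (3 * size_grid G) - Q\<^sub>0 G * mat_adjoint (Q\<^sub>0 G)) * T\<^sub>1 G \<alpha> \<beta> *
     diag_powr (\<Lambda>\<^sub>p\<^sub>p G \<alpha> \<beta> * mat_inv (\<Lambda>\<^sub>q G)) (- 1/2)"

definition P\<^sub>1 :: "grid \<Rightarrow> real \<Rightarrow> real \<Rightarrow> complex mat" where
  "P\<^sub>1 G \<alpha> \<beta> = (1\<^sub>m (3 * size_grid G) - P\<^sub>0 G * mat_adjoint (P\<^sub>0 G)) * T\<^sub>1 G \<alpha> \<beta> *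
     diag_powr (\<Lambda>\<^sub>p\<^sub>p G \<alpha> \<beta> * mat_inv (\<Lambda>\<^sub>q G)) (- 1/2)"

definition Q\<^sub>2 :: "grid \<Rightarrow> real \<Rightarrow> real \<Rightarrow> complex mat" where
  "Q\<^sub>2 G \<alpha> \<beta> = mat_adjoint (curl G) * T\<^sub>1 G \<alpha> \<beta> * diag_powr (\<Lambda>\<^sub>p\<^sub>p G \<alpha> \<beta>) (- 1/2)"

definition P\<^sub>2 :: "grid \<Rightarrow> real \<Rightarrow> real \<Rightarrow> complex mat" where
  "P\<^sub>2 G \<alpha> \<beta> = curl G * T\<^sub>1 G \<alpha> \<beta> * diag_powr (\<Lambda>\<^sub>p\<^sub>p G \<alpha> \<beta>) (- 1/2)"

definition P\<^sub>r :: "grid \<Rightarrow> real \<Rightarrow> real \<Rightarrow> complex mat" where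
  "P\<^sub>r G \<alpha> \<beta> = P\<^sub>2 G \<alpha> \<beta> @\<^sub>c P\<^sub>1 G \<alpha> \<beta>"

definition Q\<^sub>r :: "grid \<Rightarrow> real \<Rightarrow> real \<Rightarrow> complex mat" where
  "Q\<^sub>r G \<alpha> \<beta> = Q\<^sub>1 G \<alpha> \<beta> @\<^sub>c Q\<^sub>2 G \<alpha> \<beta>"

definition \<Sigma>\<^sub>r :: "grid \<Rightarrow> complex mat" where
  "\<Sigma>\<^sub>r G = diag_block_mat [diag_powr (\<Lambda>\<^sub>q G) (1/2), diag_powr (\<Lambda>\<^sub>q G) (1/2)]"


section \<open>The two eigenvalue problems\<close>

definition maxwell_lhs :: "grid \<Rightarrow> complex mat" where
  "maxwell_lhs G = diag_block_mat [curl G, mat_adjoint (curl G)]"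

definition maxwell_rhs :: "complex mat \<Rightarrow> complex mat \<Rightarrow> complex mat \<Rightarrow> complex mat \<Rightarrow> complex mat" where
  "maxwell_rhs \<mu> \<epsilon> \<xi> \<zeta> = \<i> \<cdot>\<^sub>m four_block_mat \<zeta> \<mu> (- \<epsilon>) (- \<xi>)"

definition \<Phi>_mat :: "complex mat \<Rightarrow> complex mat \<Rightarrow> complex mat \<Rightarrow> complex mat \<Rightarrow> complex mat" where
  "\<Phi>_mat \<mu> \<epsilon> \<xi> \<zeta> = \<epsilon> - \<xi> * mat_inv \<mu> * \<zeta>"

definition reduced_lhs :: "grid \<Rightarrow> complex mat" where
  "reduced_lhs G = (let S = mat_inv (\<Sigma>\<^sub>r G); Z = 0\<^sub>m (2 * size_grid G) (2 * size_grid G)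
     in \<i> \<cdot>\<^sub>m four_block_mat Z S (- S) Z)"

definition A\<^sub>r :: "grid \<Rightarrow> real \<Rightarrow> real \<Rightarrow>
    complex mat \<Rightarrow> complex mat \<Rightarrow> complex mat \<Rightarrow> complex mat \<Rightarrow> complex mat" where
  "A\<^sub>r G \<alpha> \<beta> \<mu> \<epsilon> \<xi> \<zeta> =
    (let I = 1\<^sub>m (3 * size_grid G); Z = 0\<^sub>m (3 * size_grid G) (3 * size_grid G);
         P = P\<^sub>r G \<alpha> \<beta>; Q = Q\<^sub>r G \<alpha> \<beta>
     in diag_block_mat [mat_adjoint P, mat_adjoint Q]
        * four_block_mat (mat_inv \<mu> * \<zeta>) (- I) I Z
        * diag_block_mat [mat_inv (\<Phi>_mat \<mu> \<epsilon> \<xi> \<zeta>), mat_inv \<mu>]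
        * four_block_mat (\<xi> * mat_inv \<mu>) I (- I) Z
        * diag_block_mat [P, Q])"

end

theory Submission
  imports Defs
begin

text \<open>
  Two facts carry the proof: the discrete curl has the thin singular value decomposition
  \<open>C = P\<^sub>r \<Sigma>\<^sub>r Q\<^sub>r\<^sup>*\<close> with \<open>\<Sigma>\<^sub>r\<close> invertible (lemma \<open>curl_svd\<close>), and the inverse of the
  constitutive matrix, followed by the rotation \<open>(E, H) \<mapsto> (H, -E)\<close>, is Hermitian positive
  definite (lemmas \<open>constitutive_inverse\<close> and \<open>svd_reduction\<close>).

  For the first fact, \<open>T\<close> is unitary and diagonalizes the three difference operators at once,
  so the curl acts mode by mode. On a mode whose eigenvalues form the vector
  \<open>\<lambda> = (\<lambda>\<^sub>1, \<lambda>\<^sub>2, \<lambda>\<^sub>3)\<close> it is the cross product with \<open>\<lambda>\<close>, and its adjoint is minus the cross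
  product with the conjugate of \<open>\<lambda>\<close>. The kernel of the former is spanned by \<open>\<lambda>\<close>. The constant
  vector \<open>t = (\<alpha>, \<beta>, 1)\<close> supplies the other two right singular vectors: the component of \<open>t\<close>
  orthogonal to \<open>\<lambda>\<close>, and the image of \<open>t\<close> under the adjoint. Both have the singular value
  \<open>|\<lambda>|\<close>, because \<open>C C\<^sup>*\<close> is \<open>|\<lambda>|\<^sup>2\<close> times the projection orthogonal to the conjugate of \<open>\<lambda>\<close>;
  their images are a multiple of \<open>\<lambda> \<times> t\<close> and of that projection of \<open>t\<close>. The construction breaks
  down only if \<open>\<lambda> = 0\<close> or \<open>\<lambda>\<close> is parallel to \<open>t\<close>. The bounds on the wave vector exclude the
  first case (\<open>symbol_sq_pos\<close>). In the second the three phases would coincide, since a chord of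
  the unit circle that starts at 1 is determined by the line that it spans, and then
  \<open>\<alpha> \<delta>\<^sub>x = \<beta> \<delta>\<^sub>y = \<delta>\<^sub>z\<close> would follow (\<open>cross_sq_pos\<close>).

  For the reduction put \<open>W = diag(P\<^sub>r, Q\<^sub>r)\<close>, \<open>x = (E, H)\<close>, and let \<open>B\<close> be the block matrix of
  the material parameters, so that the problem reads \<open>W y = \<i> \<omega> B x\<close> with
  \<open>y = (\<Sigma>\<^sub>r Q\<^sub>r\<^sup>* E, \<Sigma>\<^sub>r P\<^sub>r\<^sup>* H)\<close>. Block elimination gives a Hermitian positive definite \<open>M\<close>
  for which \<open>M B\<close> is the map \<open>K\<close> from \<open>(E, H)\<close> to \<open>(H, -E)\<close>. Applying \<open>W\<^sup>* M\<close> turns the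
  equation into \<open>A\<^sub>r y = \<i> \<omega> W\<^sup>* K x\<close>, and \<open>W\<^sup>* K x = (P\<^sub>r\<^sup>* H, - Q\<^sub>r\<^sup>* E)\<close> is expressed by \<open>y\<close>
  and the inverse of \<open>\<Sigma>\<^sub>r\<close> alone. Conversely \<open>x\<close> is recovered from \<open>y\<close> by solving
  \<open>\<i> \<omega> B x = W y\<close>, which needs \<open>\<omega> \<noteq> 0\<close> (\<open>gen_eigenvalue_reduction\<close>). Definiteness of \<open>A\<^sub>r\<close> is
  inherited from \<open>M\<close> because \<open>W\<close> is an isometry.
\<close>

section \<open>Adjoint, inverse and definiteness\<close>

lemma dim_mat_adjoint [simp]:
  "dim_row (mat_adjoint A) = dim_col A" "dim_col (mat_adjoint A) = dim_row A"
  unfolding mat_adjoint_def by auto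

lemma index_mat_adjoint [simp]:
  fixes A :: "complex mat"
  assumes "i < dim_col A" "j < dim_row A"
  shows "mat_adjoint A $$ (i, j) = cnj (A $$ (j, i))"
  using assms unfolding mat_adjoint_def by (simp add: mat_of_rows_def)

lemma mat_adjoint_carrier [simp, intro]:
  "A \<in> carrier_mat m n \<Longrightarrow> mat_adjoint A \<in> carrier_mat n m"
  by auto

lemma mat_adjoint_mat_adjoint [simp]: "mat_adjoint (mat_adjoint A) = (A :: complex mat)"
  by (rule eq_matI) auto

lemma mat_adjoint_one [simp]: "mat_adjoint (1\<^sub>m n) = (1\<^sub>m n :: complex mat)"
  by (rule eq_matI) auto

lemma mat_adjoint_zero [simp]: "mat_adjoint (0\<^sub>m m n) = (0\<^sub>m n m :: complex mat)"
  by (rule eq_matI) auto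

lemma mat_adjoint_uminus [simp]: "mat_adjoint (- A) = - mat_adjoint (A :: complex mat)"
  by (rule eq_matI) auto

lemma mat_adjoint_smult [simp]:
  "mat_adjoint (c \<cdot>\<^sub>m A) = cnj c \<cdot>\<^sub>m mat_adjoint (A :: complex mat)"
  by (rule eq_matI) auto

lemma mat_adjoint_mat_diag [simp]: "mat_adjoint (mat_diag n f) = mat_diag n (\<lambda>i. cnj (f i))"
  by (rule eq_matI) (auto simp: mat_diag_def)

lemma mat_adjoint_mult:
  fixes A B :: "complex mat"
  assumes "dim_col A = dim_row B"
  shows "mat_adjoint (A * B) = mat_adjoint B * mat_adjoint A"
  by (rule eq_matI)
    (use assms in \<open>auto simp: scalar_prod_def cnj_sum mult.commute intro!: sum.cong\<close>)

lemma mat_adjoint_four_block: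
  fixes A B C D :: "complex mat"
  assumes "A \<in> carrier_mat r1 c1" "B \<in> carrier_mat r1 c2" "C \<in> carrier_mat r2 c1"
      "D \<in> carrier_mat r2 c2"
  shows "mat_adjoint (four_block_mat A B C D)
    = four_block_mat (mat_adjoint A) (mat_adjoint C) (mat_adjoint B) (mat_adjoint D)"
  by (rule eq_matI) (use assms in auto)

text \<open>Side conditions on dimensions, unlike membership in a carrier set, contain no variables
  that are absent from the left-hand side, so these rules can be used for conditional
  rewriting.\<close>

lemma mult_assoc_dim:
  fixes A B C :: "'a :: semiring_0 mat"
  assumes "dim_col A = dim_row B" "dim_col B = dim_row C"
  shows "(A * B) * C = A * (B * C)"
  using assms by (intro assoc_mult_mat) auto

lemma mult_assoc_vec_dim:
  fixes A B :: "'a :: semiring_0 mat"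
  assumes "dim_col A = dim_row B" "dim_col B = dim_vec v"
  shows "(A * B) *\<^sub>v v = A *\<^sub>v (B *\<^sub>v v)"
  using assms by (intro assoc_mult_mat_vec[of _ "dim_row A" "dim_row B" _ "dim_vec v"]) auto

lemma smult_vec_dim:
  fixes A :: "'a :: comm_semiring_0 mat"
  assumes "dim_col A = dim_vec v"
  shows "(c \<cdot>\<^sub>m A) *\<^sub>v v = c \<cdot>\<^sub>v (A *\<^sub>v v)" "A *\<^sub>v (c \<cdot>\<^sub>v v) = c \<cdot>\<^sub>v (A *\<^sub>v v)"
  using assms by (auto intro!: eq_vecI simp: scalar_prod_def sum_distrib_left ac_simps)

lemma mult_mat_zero_vec [simp]:
  fixes A :: "'a :: semiring_0 mat"
  assumes "dim_col A = n"
  shows "A *\<^sub>v 0\<^sub>v n = 0\<^sub>v (dim_row A)"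
  using assms by (intro eq_vecI) auto

lemma inner_mult_mat_vec:
  fixes A :: "complex mat"
  assumes A: "A \<in> carrier_mat m n" and v: "v \<in> carrier_vec n" and w: "w \<in> carrier_vec m"
  shows "(A *\<^sub>v v) \<bullet>c w = v \<bullet>c (mat_adjoint A *\<^sub>v w)"
proof -
  have "(A *\<^sub>v v) \<bullet>c w = (\<Sum>i<m. \<Sum>j<n. A $$ (i, j) * v $ j * cnj (w $ i))"
    using A v w by (simp add: scalar_prod_def sum_distrib_right lessThan_atLeast0)
  also have "\<dots> = (\<Sum>j<n. \<Sum>i<m. A $$ (i, j) * v $ j * cnj (w $ i))"
    by (rule sum.swap)
  also have "\<dots> = v \<bullet>c (mat_adjoint A *\<^sub>v w)"
    using A v w by (auto simp: scalar_prod_def sum_distrib_left lessThan_atLeast0 intro!: sum.cong)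
  finally show ?thesis .
qed

lemma hermitian_congruence:
  fixes A X :: "complex mat"
  assumes "A \<in> carrier_mat m m" "X \<in> carrier_mat m n" "hermitian A"
  shows "hermitian (mat_adjoint X * A * X)"
  using assms by (simp add: hermitian_def mat_adjoint_mult mult_assoc_dim)

text \<open>The quadratic form of \<open>X\<^sup>* A X\<close> at \<open>v\<close> is that of \<open>A\<close> at \<open>X v\<close>.\<close>

lemma positive_definite_congruence:
  fixes A X :: "complex mat"
  assumes A: "A \<in> carrier_mat m m" and X: "X \<in> carrier_mat m n"
    and pd: "positive_definite A"
    and inj: "\<And>v. v \<in> carrier_vec n \<Longrightarrow> X *\<^sub>v v = 0\<^sub>v m \<Longrightarrow> v = 0\<^sub>v n"
  shows "positive_definite (mat_adjoint X * A * X)"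
  unfolding positive_definite_def
proof (intro conjI ballI impI)
  fix v :: "complex vec"
  assume "v \<in> carrier_vec (dim_col (mat_adjoint X * A * X))"
    and "v \<noteq> 0\<^sub>v (dim_col (mat_adjoint X * A * X))"
  then have v: "v \<in> carrier_vec n" "v \<noteq> 0\<^sub>v n" using X by auto
  have Xv: "X *\<^sub>v v \<in> carrier_vec m" using X v by auto
  have "((mat_adjoint X * A * X) *\<^sub>v v) \<bullet>c v = (mat_adjoint X *\<^sub>v (A *\<^sub>v (X *\<^sub>v v))) \<bullet>c v"
    using A X v by (simp add: mult_assoc_vec_dim)
  also have "\<dots> = (A *\<^sub>v (X *\<^sub>v v)) \<bullet>c (X *\<^sub>v v)"
    using A X v Xv by (subst inner_mult_mat_vec[of _ n m]) auto
  finally have eq: "((mat_adjoint X * A * X) *\<^sub>v v) \<bullet>c v = (A *\<^sub>v (X *\<^sub>v v)) \<bullet>c (X *\<^sub>v v)" .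
  have "X *\<^sub>v v \<noteq> 0\<^sub>v m" using inj v by auto
  then show "((mat_adjoint X * A * X) *\<^sub>v v) \<bullet>c v \<in> \<real>"
      "Re (((mat_adjoint X * A * X) *\<^sub>v v) \<bullet>c v) > 0"
    using pd Xv A unfolding positive_definite_def eq by auto
qed (use X in auto)

lemma hermitian_block_diag:
  assumes "A \<in> carrier_mat m m" "B \<in> carrier_mat n n" "hermitian A" "hermitian B"
  shows "hermitian (four_block_mat A (0\<^sub>m m n) (0\<^sub>m n m) B)"
  using assms unfolding hermitian_def by (subst mat_adjoint_four_block) auto

lemma conjugate_append_vec:
  "conjugate (v @\<^sub>v w) = conjugate v @\<^sub>v conjugate (w :: complex vec)"
  by (rule eq_vecI) auto

lemma append_vec_zero: "0\<^sub>v m @\<^sub>v 0\<^sub>v n = 0\<^sub>v (m + n)"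
  by (rule eq_vecI) auto

lemma carrier_vec_append_cases:
  assumes "v \<in> carrier_vec (m + n)"
  obtains a b where "a \<in> carrier_vec m" "b \<in> carrier_vec n" "v = a @\<^sub>v b"
  using assms by (metis vec_first_last_append vec_first_carrier vec_last_carrier)

lemma positive_definite_block_diag:
  assumes A: "A \<in> carrier_mat m m" and B: "B \<in> carrier_mat n n"
    and pd: "positive_definite A" "positive_definite B"
  shows "positive_definite (four_block_mat A (0\<^sub>m m n) (0\<^sub>m n m) B)" (is "positive_definite ?D")
proof -
  have "(?D *\<^sub>v v) \<bullet>c v \<in> \<real> \<and> Re ((?D *\<^sub>v v) \<bullet>c v) > 0"
    if v: "v \<in> carrier_vec (m + n)" "v \<noteq> 0\<^sub>v (m + n)" for v
  proof -
    obtain a b where ab: "a \<in> carrier_vec m" "b \<in> carrier_vec n" "v = a @\<^sub>v b"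
      using v(1) by (rule carrier_vec_append_cases)
    have eq: "(?D *\<^sub>v v) \<bullet>c v = (A *\<^sub>v a) \<bullet>c a + (B *\<^sub>v b) \<bullet>c b"
      unfolding ab(3) mult_mat_vec_split[OF A B ab(1,2)] conjugate_append_vec
      using A B ab by (intro scalar_prod_append[of _ m _ n]) auto
    have a: "(A *\<^sub>v a) \<bullet>c a \<in> \<real> \<and> (a \<noteq> 0\<^sub>v m \<longrightarrow> Re ((A *\<^sub>v a) \<bullet>c a) > 0)
        \<and> Re ((A *\<^sub>v a) \<bullet>c a) \<ge> 0"
      using pd(1) A ab(1) unfolding positive_definite_def
          by (cases "a = 0\<^sub>v m") (auto intro: less_imp_le)
    have b: "(B *\<^sub>v b) \<bullet>c b \<in> \<real> \<and> (b \<noteq> 0\<^sub>v n \<longrightarrow> Re ((B *\<^sub>v b) \<bullet>c b) > 0)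
        \<and> Re ((B *\<^sub>v b) \<bullet>c b) \<ge> 0"
      using pd(2) B ab(2) unfolding positive_definite_def
          by (cases "b = 0\<^sub>v n") (auto intro: less_imp_le)
    have "a \<noteq> 0\<^sub>v m \<or> b \<noteq> 0\<^sub>v n"
      using v(2) ab by (auto simp: append_vec_zero)
    then show ?thesis
      unfolding eq using a b by (auto intro: add_pos_nonneg add_nonneg_pos)
  qed
  then show ?thesis
    using A B unfolding positive_definite_def by auto
qed

lemma mat_inv_eqI:
  assumes A: "A \<in> carrier_mat n n" and B: "B \<in> carrier_mat n n" and AB: "A * B = 1\<^sub>m n"
  shows "mat_inv A = B"
proof -
  have "A \<in> Units (ring_mat TYPE(complex) n ())"
    using A B AB mat_mult_left_right_inverse[OF A B AB]
    unfolding Units_def by (auto simp: ring_mat_def)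
  then obtain B' where B': "mat_inverse A = Some B'"
    using mat_inverse(1)[OF A, where b = "()"] by (cases "mat_inverse A") auto
  have "B' * A = 1\<^sub>m n" "B' \<in> carrier_mat n n"
    using mat_inverse(2)[OF A B'] by auto
  then have "B' = B"
    using A B AB assoc_mult_mat[of B' n n A n B n] by simp
  then show ?thesis
    using B' by (simp add: mat_inv_def)
qed

lemma positive_definite_inverse:
  assumes A: "A \<in> carrier_mat n n" and pd: "positive_definite A"
  shows "mat_inv A \<in> carrier_mat n n" "A * mat_inv A = 1\<^sub>m n" "mat_inv A * A = 1\<^sub>m n"
proof -
  have "\<not> (\<exists>v. v \<in> carrier_vec n \<and> v \<noteq> 0\<^sub>v n \<and> A *\<^sub>v v = 0\<^sub>v n)"
  proof
    assume "\<exists>v. v \<in> carrier_vec n \<and> v \<noteq> 0\<^sub>v n \<and> A *\<^sub>v v = 0\<^sub>v n"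
    then obtain v where v: "v \<in> carrier_vec n" "v \<noteq> 0\<^sub>v n" "A *\<^sub>v v = 0\<^sub>v n" by auto
    then have "Re ((A *\<^sub>v v) \<bullet>c v) > 0"
      using pd A unfolding positive_definite_def by auto
    then show False using v by auto
  qed
  then have "det A \<noteq> 0"
    using det_0_iff_vec_prod_zero_field[OF A] by blast
  then have "A \<in> Units (ring_mat TYPE(complex) n ())"
    by (rule det_non_zero_imp_unit[OF A])
  then obtain B where "mat_inverse A = Some B"
    using mat_inverse(1)[OF A, where b = "()"] by (cases "mat_inverse A") auto
  with mat_inverse(2)[OF A this]
  show "mat_inv A \<in> carrier_mat n n" "A * mat_inv A = 1\<^sub>m n" "mat_inv A * A = 1\<^sub>m n"
    by (auto simp: mat_inv_def)
qed

lemma hermitian_inverse: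
  assumes A: "A \<in> carrier_mat n n" and pd: "positive_definite A" and "hermitian A"
  shows "hermitian (mat_inv A)"
proof -
  note inv = positive_definite_inverse[OF A pd]
  have "A * mat_adjoint (mat_inv A) = mat_adjoint (mat_inv A * A)"
    using assms inv by (subst mat_adjoint_mult) (auto simp: hermitian_def)
  then have "A * mat_adjoint (mat_inv A) = 1\<^sub>m n"
    using inv by simp
  then have "mat_inv A = mat_adjoint (mat_inv A)"
    using A inv by (intro mat_inv_eqI) auto
  then show ?thesis by (simp add: hermitian_def)
qed

text \<open>The inverse \<open>B\<close> of a Hermitian matrix \<open>A\<close> is congruent to it, as \<open>B = B\<^sup>* A B\<close>.\<close>

lemma positive_definite_mat_inv:
  assumes A: "A \<in> carrier_mat n n" and pd: "positive_definite A" and h: "hermitian A"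
  shows "positive_definite (mat_inv A)"
proof -
  note inv = positive_definite_inverse[OF A pd]
  have "mat_adjoint (mat_inv A) * A * mat_inv A = mat_inv A"
    using hermitian_inverse[OF assms] inv A by (simp add: hermitian_def mult_assoc_dim)
  moreover have "positive_definite (mat_adjoint (mat_inv A) * A * mat_inv A)"
  proof (rule positive_definite_congruence[OF A inv(1) pd])
    fix v assume v: "v \<in> carrier_vec n" "mat_inv A *\<^sub>v v = 0\<^sub>v n"
    have "v = (A * mat_inv A) *\<^sub>v v" using v inv by simp
    also have "\<dots> = A *\<^sub>v (mat_inv A *\<^sub>v v)" using A inv v by (intro assoc_mult_mat_vec) auto
    also have "\<dots> = 0\<^sub>v n" using A v by auto
    finally show "v = 0\<^sub>v n" .
  qed
  ultimately show ?thesis by simp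
qed

section \<open>Reduction of the generalized eigenvalue problem\<close>

text \<open>The abstract form of the reduction: \<open>K\<close> and \<open>K'\<close> are the rotations \<open>(E, H) \<mapsto> (H, -E)\<close> of
  the full and of the reduced space, and \<open>swap\<close> says that \<open>V\<close> intertwines them up to exchanging
  the roles of the left and the right singular vectors. Eigenvectors correspond by \<open>y = R V x\<close>.\<close>

lemma gen_eigenvalue_reduction:
  fixes \<omega> :: complex
  assumes carr: "W \<in> carrier_mat N k" "R \<in> carrier_mat k k" "Ri \<in> carrier_mat k k"
    "V \<in> carrier_mat k N" "B \<in> carrier_mat N N" "M \<in> carrier_mat N N"
    "K \<in> carrier_mat N N" "K' \<in> carrier_mat k k"
    and L: "L = W * R * V" and inv: "R * Ri = 1\<^sub>m k" "Ri * R = 1\<^sub>m k"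
    and K: "mat_adjoint K * K = 1\<^sub>m N" and K': "mat_adjoint K' * K' = 1\<^sub>m k"
    and swap: "K' * V = mat_adjoint W * K" and MB: "M * B = K" and \<omega>: "\<omega> \<noteq> 0"
  shows "gen_eigenvalue N L (\<i> \<cdot>\<^sub>m B) \<omega>
    \<longleftrightarrow> gen_eigenvalue k (\<i> \<cdot>\<^sub>m (K' * Ri)) (mat_adjoint W * M * W) (inverse \<omega>)"
proof
  have dims [simp]: "dim_row W = N" "dim_col W = k" "dim_row R = k" "dim_col R = k"
    "dim_row Ri = k" "dim_col Ri = k" "dim_row V = k" "dim_col V = N" "dim_row B = N"
    "dim_col B = N" "dim_row M = N" "dim_col M = N" "dim_row K = N" "dim_col K = N"
    "dim_row K' = k" "dim_col K' = k"
    using carr by auto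
  note vec_simps = mult_assoc_vec_dim smult_vec_dim smult_smult_assoc
  have cancel: "X *\<^sub>v (Y *\<^sub>v u) = Z *\<^sub>v u"
    if "X * Y = Z" "dim_col X = dim_row Y" "dim_col Y = dim_vec u" for X Y Z :: "complex mat" and u
    using that mult_assoc_vec_dim by metis
  have RiR: "Ri *\<^sub>v (R *\<^sub>v u) = u" and RRi: "R *\<^sub>v (Ri *\<^sub>v u) = u"
    and K'K': "mat_adjoint K' *\<^sub>v (K' *\<^sub>v u) = u" if "u \<in> carrier_vec k" for u
    using that cancel[OF inv(2), of u] cancel[OF inv(1), of u] cancel[OF K', of u] by auto
  have MBv: "M *\<^sub>v (B *\<^sub>v u) = K *\<^sub>v u" and KKv: "mat_adjoint K *\<^sub>v (K *\<^sub>v u) = u"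
    if "u \<in> carrier_vec N" for u
    using that cancel[OF MB, of u] cancel[OF K, of u] by auto
  have swapv: "K' *\<^sub>v (V *\<^sub>v u) = mat_adjoint W *\<^sub>v (K *\<^sub>v u)" if "u \<in> carrier_vec N" for u
    using that cancel[OF swap, of u] by (simp add: mult_assoc_vec_dim)
  {
    assume "gen_eigenvalue N L (\<i> \<cdot>\<^sub>m B) \<omega>"
    then obtain x where x: "x \<in> carrier_vec N" "x \<noteq> 0\<^sub>v N" "L *\<^sub>v x = \<omega> \<cdot>\<^sub>v ((\<i> \<cdot>\<^sub>m B) *\<^sub>v x)"
      unfolding gen_eigenvalue_def by auto
    \<comment> \<open>With this choice \<open>L x = W y\<close>, and \<open>M\<close> removes \<open>B\<close> from the right-hand side.\<close>
    define y where "y = R *\<^sub>v (V *\<^sub>v x)"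
    have y: "y \<in> carrier_vec k" by (rule carrier_vecI) (simp add: y_def)
    have [simp]: "dim_vec x = N" "dim_vec y = k" by (rule carrier_vecD, fact)+
    have Wy: "W *\<^sub>v y = (\<omega> * \<i>) \<cdot>\<^sub>v (B *\<^sub>v x)"
      using x(3) by (simp add: L y_def vec_simps)
    have "M *\<^sub>v (W *\<^sub>v y) = (\<omega> * \<i>) \<cdot>\<^sub>v (K *\<^sub>v x)"
      by (simp add: Wy vec_simps MBv[OF x(1)])
    then have "(mat_adjoint W * M * W) *\<^sub>v y = (\<omega> * \<i>) \<cdot>\<^sub>v (K' *\<^sub>v (V *\<^sub>v x))"
      by (simp add: vec_simps swapv[OF x(1)])
    then have "inverse \<omega> \<cdot>\<^sub>v ((mat_adjoint W * M * W) *\<^sub>v y)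
        = (inverse \<omega> * (\<omega> * \<i>)) \<cdot>\<^sub>v (K' *\<^sub>v (V *\<^sub>v x))"
      by (simp only: smult_smult_assoc)
    also have "inverse \<omega> * (\<omega> * \<i>) = \<i>"
      using \<omega> by simp
    finally have *: "inverse \<omega> \<cdot>\<^sub>v ((mat_adjoint W * M * W) *\<^sub>v y)
        = \<i> \<cdot>\<^sub>v (K' *\<^sub>v (V *\<^sub>v x))" .
    have "Ri *\<^sub>v y = V *\<^sub>v x"
      unfolding y_def using carr x(1) by (intro RiR) auto
    then have "(\<i> \<cdot>\<^sub>m (K' * Ri)) *\<^sub>v y = inverse \<omega> \<cdot>\<^sub>v ((mat_adjoint W * M * W) *\<^sub>v y)"
      unfolding * by (simp add: vec_simps)
    moreover have "y \<noteq> 0\<^sub>v k"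
    proof
      assume "y = 0\<^sub>v k"
      then have "(\<omega> * \<i>) \<cdot>\<^sub>v (B *\<^sub>v x) = 0\<^sub>v N"
        unfolding Wy[symmetric] by simp
      then have "(1 / (\<omega> * \<i>)) \<cdot>\<^sub>v ((\<omega> * \<i>) \<cdot>\<^sub>v (B *\<^sub>v x)) = (1 / (\<omega> * \<i>)) \<cdot>\<^sub>v 0\<^sub>v N"
        by (rule arg_cong)
      also have "\<dots> = 0\<^sub>v N"
        by (intro eq_vecI) auto
      finally have Bx: "B *\<^sub>v x = 0\<^sub>v N"
        unfolding smult_smult_assoc using \<omega> by simp
      have "K *\<^sub>v x = 0\<^sub>v N"
        unfolding MBv[OF x(1), symmetric] Bx by simp
      then have "x = 0\<^sub>v N"
        using KKv[OF x(1)] by simp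
      then show False using x(2) by simp
    qed
    ultimately show "gen_eigenvalue k (\<i> \<cdot>\<^sub>m (K' * Ri)) (mat_adjoint W * M * W) (inverse \<omega>)"
      unfolding gen_eigenvalue_def using y by auto
  }
  {
    assume "gen_eigenvalue k (\<i> \<cdot>\<^sub>m (K' * Ri)) (mat_adjoint W * M * W) (inverse \<omega>)"
    then obtain y where y: "y \<in> carrier_vec k" "y \<noteq> 0\<^sub>v k"
      "(\<i> \<cdot>\<^sub>m (K' * Ri)) *\<^sub>v y = inverse \<omega> \<cdot>\<^sub>v ((mat_adjoint W * M * W) *\<^sub>v y)"
      unfolding gen_eigenvalue_def by auto
    \<comment> \<open>The solution of \<open>\<i> \<omega> B x = W y\<close>, since \<open>K\<^sup>* M\<close> inverts \<open>B\<close>.\<close>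
    define x where "x = (1 / (\<omega> * \<i>)) \<cdot>\<^sub>v (mat_adjoint K *\<^sub>v (M *\<^sub>v (W *\<^sub>v y)))"
    have x: "x \<in> carrier_vec N" by (rule carrier_vecI) (simp add: x_def)
    have [simp]: "dim_vec x = N" "dim_vec y = k" by (rule carrier_vecD, fact)+
    have KK: "K * mat_adjoint K = 1\<^sub>m N"
      by (rule mat_mult_left_right_inverse[OF _ _ K]) (use carr in auto)
    have MB1: "(mat_adjoint K * M) * B = 1\<^sub>m N"
      by (simp add: mult_assoc_dim MB K)
    have BM: "B * (mat_adjoint K * M) = 1\<^sub>m N"
      by (rule mat_mult_left_right_inverse[OF _ _ MB1]) (rule carrier_matI; simp)+
    have "B *\<^sub>v (mat_adjoint K *\<^sub>v (M *\<^sub>v (W *\<^sub>v y))) = (B * (mat_adjoint K * M)) *\<^sub>v (W *\<^sub>v y)"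
      by (simp add: vec_simps)
    also have "\<dots> = W *\<^sub>v y" unfolding BM using carr y(1) by auto
    finally have Bx: "B *\<^sub>v x = (1 / (\<omega> * \<i>)) \<cdot>\<^sub>v (W *\<^sub>v y)"
      by (simp add: x_def vec_simps)
    have "K *\<^sub>v (mat_adjoint K *\<^sub>v (M *\<^sub>v (W *\<^sub>v y))) = (K * mat_adjoint K) *\<^sub>v (M *\<^sub>v (W *\<^sub>v y))"
      by (simp add: vec_simps)
    also have "\<dots> = M *\<^sub>v (W *\<^sub>v y)" unfolding KK using carr y(1) by auto
    finally have "K *\<^sub>v x = (1 / (\<omega> * \<i>)) \<cdot>\<^sub>v (M *\<^sub>v (W *\<^sub>v y))"
      by (simp add: x_def vec_simps)
    then have "K' *\<^sub>v (V *\<^sub>v x) = (1 / (\<omega> * \<i>)) \<cdot>\<^sub>v ((mat_adjoint W * M * W) *\<^sub>v y)"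
      by (simp add: vec_simps swapv[OF x])
    also have "1 / (\<omega> * \<i>) = (1 / \<i>) * inverse \<omega>"
      by (simp add: divide_inverse mult.commute)
    also have "((1 / \<i>) * inverse \<omega>) \<cdot>\<^sub>v ((mat_adjoint W * M * W) *\<^sub>v y)
        = (1 / \<i>) \<cdot>\<^sub>v ((\<i> \<cdot>\<^sub>m (K' * Ri)) *\<^sub>v y)"
      unfolding y(3) smult_smult_assoc ..
    also have "\<dots> = K' *\<^sub>v (Ri *\<^sub>v y)" by (simp add: vec_simps)
    finally have "mat_adjoint K' *\<^sub>v (K' *\<^sub>v (V *\<^sub>v x)) = mat_adjoint K' *\<^sub>v (K' *\<^sub>v (Ri *\<^sub>v y))"
      by simp
    then have "V *\<^sub>v x = Ri *\<^sub>v y"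
      using carr x(1) y(1) by (subst (asm) (1 2) K'K') auto
    then have Ry: "R *\<^sub>v (V *\<^sub>v x) = y"
      using RRi[OF y(1)] by simp
    then have "L *\<^sub>v x = \<omega> \<cdot>\<^sub>v ((\<i> \<cdot>\<^sub>m B) *\<^sub>v x)"
      using \<omega> by (simp add: L vec_simps Bx)
    moreover have "x \<noteq> 0\<^sub>v N"
      using Ry y(2) carr by auto
    ultimately show "gen_eigenvalue N L (\<i> \<cdot>\<^sub>m B) \<omega>"
      unfolding gen_eigenvalue_def using x by auto
  }
qed

section \<open>Block matrices and the constitutive relations\<close>

definition block_diag :: "complex mat \<Rightarrow> complex mat \<Rightarrow> complex mat" where
  "block_diag A B = four_block_mat A (0\<^sub>m (dim_row A) (dim_col B)) (0\<^sub>m (dim_row B) (dim_col A)) B"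

lemma dim_block_diag [simp]:
  "dim_row (block_diag A B) = dim_row A + dim_row B"
  "dim_col (block_diag A B) = dim_col A + dim_col B"
  by (simp_all add: block_diag_def)

lemma uminus_zero_matrix [simp]: "- (0\<^sub>m a b) = (0\<^sub>m a b :: 'a :: group_add mat)"
  by (rule eq_matI) auto

text \<open>The rotation \<open>(E, H) \<mapsto> (H, -E)\<close>.\<close>

abbreviation swap_mat :: "nat \<Rightarrow> complex mat" where
  "swap_mat n \<equiv> four_block_mat (0\<^sub>m n n) (1\<^sub>m n) (- 1\<^sub>m n) (0\<^sub>m n n)"

lemma diag_block_mat_pair: "diag_block_mat [A, B] = block_diag A B"
  by (simp add: Let_def block_diag_def del: diag_block_mat.simps(2) add:
      diag_block_mat.simps(2)[of A "[B]"])

lemma block_diag_mult: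
  assumes "dim_col A = dim_row C" "dim_col B = dim_row D"
  shows "block_diag A B * block_diag C D = block_diag (A * C) (B * D)"
  unfolding block_diag_def
  by (subst mult_four_block_mat[of _ "dim_row A" "dim_col A" _ "dim_col B" _ "dim_row B" _ _
      "dim_col C" _ "dim_col D"])
    (use assms in auto)

lemma mat_adjoint_block_diag:
    "mat_adjoint (block_diag A B) = block_diag (mat_adjoint A) (mat_adjoint B)"
  unfolding block_diag_def
  by (subst mat_adjoint_four_block[of _ "dim_row A" "dim_col A" _ "dim_col B" _ "dim_row B"]) auto

lemma swap_mat_orthogonal: "mat_adjoint (swap_mat n) * swap_mat n = 1\<^sub>m (n + n)"
proof -
  have adj: "mat_adjoint (swap_mat n) = four_block_mat (0\<^sub>m n n) (- 1\<^sub>m n) (1\<^sub>m n) (0\<^sub>m n n)"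
    by (subst mat_adjoint_four_block[of _ n n _ n _ n]) auto
  have "- 1\<^sub>m n * - 1\<^sub>m n = (1\<^sub>m n :: complex mat)"
    by (subst uminus_mult_left_mat) auto
  then show ?thesis
    unfolding adj by (subst mult_four_block_mat[of _ n n _ n _ n _ _ n _ n]) auto
qed

text \<open>Block Gaussian elimination: the rightmost factor of the inverse removes \<open>\<mu>\<close> from the
  first block row, which leaves the Schur complement \<open>- (\<epsilon> - \<xi> \<mu>\<^sup>-\<^sup>1 \<zeta>)\<close>; the diagonal factor
  normalizes it, and the left factor clears what remains of \<open>\<zeta>\<close>.\<close>

lemma constitutive_inverse:
  fixes \<mu> \<epsilon> \<xi> \<zeta> Mi Fi :: "complex mat"
  assumes [simp]: "\<mu> \<in> carrier_mat m m" "\<epsilon> \<in> carrier_mat m m" "\<xi> \<in> carrier_mat m m"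
      "\<zeta> \<in> carrier_mat m m"
    "Mi \<in> carrier_mat m m" "Fi \<in> carrier_mat m m"
    and Mi: "Mi * \<mu> = 1\<^sub>m m" and Fi: "Fi * (\<epsilon> - \<xi> * Mi * \<zeta>) = 1\<^sub>m m"
  shows "four_block_mat (Mi * \<zeta>) (- 1\<^sub>m m) (1\<^sub>m m) (0\<^sub>m m m) * block_diag Fi Mi
      * four_block_mat (\<xi> * Mi) (1\<^sub>m m) (- 1\<^sub>m m) (0\<^sub>m m m) * four_block_mat \<zeta> \<mu> (- \<epsilon>) (- \<xi>)
    = swap_mat m" (is "?N1 * ?D * ?N2 * ?B = _")
proof -
  have [simp]: "dim_row \<mu> = m" "dim_col \<mu> = m" "dim_row \<epsilon> = m" "dim_col \<epsilon> = m" "dim_row \<xi> = m"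
      "dim_col \<xi> = m"
    "dim_row \<zeta> = m" "dim_col \<zeta> = m" "dim_row Mi = m" "dim_col Mi = m" "dim_row Fi = m"
        "dim_col Fi = m"
    using assms(1-6) by (auto simp del: assms(1-6))
  define \<Phi> where "\<Phi> = \<epsilon> - \<xi> * Mi * \<zeta>"
  have [simp]: "\<Phi> \<in> carrier_mat m m" "dim_row \<Phi> = m" "dim_col \<Phi> = m" by (auto simp: \<Phi>_def)
  have um: "- 1\<^sub>m m * X = - X" if "X \<in> carrier_mat m m" for X :: "complex mat"
    using that by (subst uminus_mult_left_mat) auto
  have mu: "X * - Y = - (X * Y)" if "X \<in> carrier_mat m m" "Y \<in> carrier_mat m m" for X Y ::
      "complex mat"
    using that by (subst uminus_mult_right_mat) auto
  have a: "\<xi> * Mi * \<zeta> + - \<epsilon> = - \<Phi>"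
    unfolding \<Phi>_def by (rule eq_matI) auto
  have b: "\<xi> * Mi * \<mu> + - \<xi> = 0\<^sub>m m m"
    by (simp add: mult_assoc_dim Mi) (rule eq_matI, auto)
  have N2B: "?N2 * ?B = four_block_mat (- \<Phi>) (0\<^sub>m m m) (- \<zeta>) (- \<mu>)"
    by (subst mult_four_block_mat[of _ m m _ m _ m _ _ m _ m]) (auto simp: um a b)
  have DN2B: "?D * (?N2 * ?B) = four_block_mat (- 1\<^sub>m m) (0\<^sub>m m m) (- (Mi * \<zeta>)) (- 1\<^sub>m m)"
    unfolding N2B block_diag_def
    by (subst mult_four_block_mat[of _ m m _ m _ m _ _ m _ m])
      (auto simp: mu Mi Fi[folded \<Phi>_def])
  have c: "- (Mi * \<zeta>) + Mi * \<zeta> = 0\<^sub>m m m"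
    by (rule eq_matI) auto
  have d: "- (- A) = A" for A :: "complex mat"
    by (rule eq_matI) auto
  have "?N1 * (?D * (?N2 * ?B)) = swap_mat m"
    unfolding DN2B
    by (subst mult_four_block_mat[of _ m m _ m _ m _ _ m _ m]) (auto simp: um mu c d)
  then show ?thesis
    by (simp add: mult_assoc_dim)
qed

text \<open>The reduction for an arbitrary square matrix with a thin singular value decomposition.
  The matrix \<open>A\<close> is \<open>W\<^sup>* N\<^sup>* D N W\<close> with \<open>D\<close> positive definite and \<open>N\<close>, \<open>W\<close> injective: the
  relation \<open>\<xi>\<^sup>* = \<zeta>\<close> is what makes the two outer factors of the constitutive inverse adjoint to
  each other.\<close>

lemma svd_reduction:
  fixes \<mu> \<epsilon> \<xi> \<zeta> C P Q S Si :: "complex mat"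
  assumes PQ: "P \<in> carrier_mat m r" "Q \<in> carrier_mat m r"
    and S: "S \<in> carrier_mat r r" "Si \<in> carrier_mat r r" "S * Si = 1\<^sub>m r" "mat_adjoint S = S"
    and C: "C = P * S * mat_adjoint Q"
    and iso: "mat_adjoint P * P = 1\<^sub>m r" "mat_adjoint Q * Q = 1\<^sub>m r"
    and carr: "\<mu> \<in> carrier_mat m m" "\<epsilon> \<in> carrier_mat m m" "\<xi> \<in> carrier_mat m m"
        "\<zeta> \<in> carrier_mat m m"
    and \<mu>: "hermitian \<mu>" "positive_definite \<mu>"
    and \<Phi>: "hermitian (\<epsilon> - \<xi> * mat_inv \<mu> * \<zeta>)" "positive_definite (\<epsilon> - \<xi> * mat_inv \<mu> * \<zeta>)"
    and \<xi>\<zeta>: "mat_adjoint \<xi> = \<zeta>"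
  defines "A \<equiv> block_diag (mat_adjoint P) (mat_adjoint Q)
      * four_block_mat (mat_inv \<mu> * \<zeta>) (- 1\<^sub>m m) (1\<^sub>m m) (0\<^sub>m m m)
      * block_diag (mat_inv (\<epsilon> - \<xi> * mat_inv \<mu> * \<zeta>)) (mat_inv \<mu>)
      * four_block_mat (\<xi> * mat_inv \<mu>) (1\<^sub>m m) (- 1\<^sub>m m) (0\<^sub>m m m) * block_diag P Q"
    and "J \<equiv> four_block_mat (0\<^sub>m r r) Si (- Si) (0\<^sub>m r r)"
  shows "\<omega> \<noteq> 0 \<Longrightarrow> gen_eigenvalue (m + m) (block_diag C (mat_adjoint C))
        (\<i> \<cdot>\<^sub>m four_block_mat \<zeta> \<mu> (- \<epsilon>) (- \<xi>)) \<omega>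
      \<longleftrightarrow> gen_eigenvalue (r + r) (\<i> \<cdot>\<^sub>m J) A (inverse \<omega>)"
    and "mat_kernel (\<i> \<cdot>\<^sub>m J) = {0\<^sub>v (r + r)}"
    and "hermitian A" and "positive_definite A"
proof -
  define Mi where "Mi = mat_inv \<mu>"
  define F where "F = \<epsilon> - \<xi> * mat_inv \<mu> * \<zeta>"
  define Fi where "Fi = mat_inv F"
  have Mi: "Mi \<in> carrier_mat m m" "Mi * \<mu> = 1\<^sub>m m" "\<mu> * Mi = 1\<^sub>m m" "hermitian Mi"
      "positive_definite Mi"
    unfolding Mi_def using carr(1) \<mu>
    by (simp_all add: positive_definite_inverse hermitian_inverse positive_definite_mat_inv)
  have F: "F \<in> carrier_mat m m"
    unfolding F_def Mi_def[symmetric] using carr Mi(1) by auto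
  have Fi: "Fi \<in> carrier_mat m m" "Fi * F = 1\<^sub>m m" "F * Fi = 1\<^sub>m m" "hermitian Fi"
      "positive_definite Fi"
    unfolding Fi_def using F \<Phi>[folded F_def]
    by (simp_all add: positive_definite_inverse hermitian_inverse positive_definite_mat_inv)
  have dims [simp]: "dim_row P = m" "dim_col P = r" "dim_row Q = m" "dim_col Q = r" "dim_row S = r"
    "dim_col S = r" "dim_row Si = r" "dim_col Si = r" "dim_row \<mu> = m" "dim_col \<mu> = m"
    "dim_row \<epsilon> = m" "dim_col \<epsilon> = m" "dim_row \<xi> = m" "dim_col \<xi> = m" "dim_row \<zeta> = m" "dim_col \<zeta> = m"
    "dim_row Mi = m" "dim_col Mi = m" "dim_row Fi = m" "dim_col Fi = m"
    using PQ S carr Mi(1) Fi(1) by auto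
  have SiS: "Si * S = 1\<^sub>m r"
    by (rule mat_mult_left_right_inverse[OF _ _ S(3)]) (use S in auto)
  define W where "W = block_diag P Q"
  define R where "R = block_diag S S"
  define Ri where "Ri = block_diag Si Si"
  define V where "V = block_diag (mat_adjoint Q) (mat_adjoint P)"
  define B where "B = four_block_mat \<zeta> \<mu> (- \<epsilon>) (- \<xi>)"
  define N where "N = four_block_mat (\<xi> * Mi) (1\<^sub>m m) (- 1\<^sub>m m) (0\<^sub>m m m)"
  define D where "D = block_diag Fi Mi"
  define M where "M = mat_adjoint N * D * N"
  have wdims [simp]: "dim_row W = m + m" "dim_col W = r + r" "dim_row R = r + r" "dim_col R = r + r"
    "dim_row Ri = r + r" "dim_col Ri = r + r" "dim_row V = r + r" "dim_col V = m + m"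
    "dim_row B = m + m" "dim_col B = m + m" "dim_row N = m + m" "dim_col N = m + m"
    "dim_row D = m + m" "dim_col D = m + m" "dim_row M = m + m" "dim_col M = m + m"
    by (simp_all add: W_def R_def Ri_def V_def B_def N_def D_def M_def)
  have adjC: "mat_adjoint C = Q * S * mat_adjoint P"
    unfolding C by (simp add: mat_adjoint_mult S(4) mult_assoc_dim)
  have L: "block_diag C (mat_adjoint C) = W * R * V"
    unfolding W_def R_def V_def adjC by (simp add: block_diag_mult C)
  have one: "block_diag (1\<^sub>m r) (1\<^sub>m r) = 1\<^sub>m (r + r)"
    by (simp add: block_diag_def)
  have RRi: "R * Ri = 1\<^sub>m (r + r)" "Ri * R = 1\<^sub>m (r + r)"
    unfolding R_def Ri_def using one by (simp_all add: block_diag_mult S(3) SiS)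
  have adjW: "mat_adjoint W = block_diag (mat_adjoint P) (mat_adjoint Q)"
    unfolding W_def by (rule mat_adjoint_block_diag)
  have adjN: "mat_adjoint N = four_block_mat (Mi * \<zeta>) (- 1\<^sub>m m) (1\<^sub>m m) (0\<^sub>m m m)"
    unfolding N_def
    by (subst mat_adjoint_four_block[of _ m m _ m _ m])
      (use carr Mi in \<open>auto simp: mat_adjoint_mult hermitian_def \<xi>\<zeta>\<close>)
  have um: "- 1\<^sub>m a * X = - X" "Y * - 1\<^sub>m a = - Y"
    if "X \<in> carrier_mat a b" "Y \<in> carrier_mat b a" for X Y :: "complex mat" and a b
    using that by (subst uminus_mult_left_mat, auto)
  have adjPQ [simp]: "mat_adjoint P \<in> carrier_mat r m" "mat_adjoint Q \<in> carrier_mat r m"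
    using PQ by auto
  have swap: "swap_mat r * V = mat_adjoint W * swap_mat m"
  proof -
    have "swap_mat r * V = four_block_mat (0\<^sub>m r m) (mat_adjoint P) (- mat_adjoint Q) (0\<^sub>m r m)"
      unfolding V_def block_diag_def
      by (subst mult_four_block_mat[of _ r r _ r _ r _ _ m _ m]) (auto simp: um[of _ r m "0\<^sub>m m r"])
    moreover have "mat_adjoint W * swap_mat m
        = four_block_mat (0\<^sub>m r m) (mat_adjoint P) (- mat_adjoint Q) (0\<^sub>m r m)"
      unfolding adjW block_diag_def
      by (subst mult_four_block_mat[of _ r m _ m _ r _ _ m _ m]) (auto simp: um[of "0\<^sub>m m r" m r])
    ultimately show ?thesis by simp
  qed
  have J: "J = swap_mat r * Ri"
    unfolding J_def Ri_def block_diag_def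
    by (subst mult_four_block_mat[of _ r r _ r _ r _ _ r _ r])
        (use S(2) in \<open>auto simp: um[of _ r r "0\<^sub>m r r"]\<close>)
  have A: "A = mat_adjoint W * M * W"
    unfolding A_def M_def adjW[symmetric] adjN F_def[symmetric]
    unfolding Fi_def[symmetric] Mi_def[symmetric]
    unfolding D_def[symmetric] N_def[symmetric] W_def[symmetric] by (simp add: mult_assoc_dim)
  have MB: "M * B = swap_mat m"
    unfolding M_def adjN unfolding B_def N_def D_def
    using carr Mi Fi unfolding F_def Mi_def[symmetric] by (intro constitutive_inverse) auto
  have c: "W \<in> carrier_mat (m + m) (r + r)" "R \<in> carrier_mat (r + r) (r + r)"
      "Ri \<in> carrier_mat (r + r) (r + r)"
    "V \<in> carrier_mat (r + r) (m + m)" "B \<in> carrier_mat (m + m) (m + m)"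
        "M \<in> carrier_mat (m + m) (m + m)"
    "swap_mat m \<in> carrier_mat (m + m) (m + m)" "swap_mat r \<in> carrier_mat (r + r) (r + r)"
    by (rule carrier_matI; simp)+
  show "gen_eigenvalue (m + m) (block_diag C (mat_adjoint C))
        (\<i> \<cdot>\<^sub>m four_block_mat \<zeta> \<mu> (- \<epsilon>) (- \<xi>)) \<omega>
      \<longleftrightarrow> gen_eigenvalue (r + r) (\<i> \<cdot>\<^sub>m J) A (inverse \<omega>)" if "\<omega> \<noteq> 0"
    unfolding A J B_def[symmetric]
    by (rule gen_eigenvalue_reduction[OF c L RRi swap_mat_orthogonal swap_mat_orthogonal swap MB
        that])
  have hD: "hermitian D" "positive_definite D"
    unfolding D_def block_diag_def
        using Fi Mi hermitian_block_diag[of Fi m Mi m] positive_definite_block_diag[of Fi m Mi m]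
    by simp_all
  have Dc: "D \<in> carrier_mat (m + m) (m + m)" and Nc: "N \<in> carrier_mat (m + m) (m + m)"
    by (rule carrier_matI; simp)+
  show "hermitian A"
    unfolding A M_def by (intro hermitian_congruence[OF _ c(1)] hermitian_congruence[OF Dc Nc]
        hD(1))
      (use c(6) in \<open>simp add: M_def\<close>)
  have "N *\<^sub>v v = 0\<^sub>v (m + m) \<Longrightarrow> v = 0\<^sub>v (m + m)" if v: "v \<in> carrier_vec (m + m)" for v
  proof -
    assume Nv: "N *\<^sub>v v = 0\<^sub>v (m + m)"
    obtain a b where ab: "a \<in> carrier_vec m" "b \<in> carrier_vec m" "v = a @\<^sub>v b"
      using v by (rule carrier_vec_append_cases)
    have "N *\<^sub>v v = ((\<xi> * Mi) *\<^sub>v a + 1\<^sub>m m *\<^sub>v b) @\<^sub>v (- 1\<^sub>m m *\<^sub>v a + 0\<^sub>m m m *\<^sub>v b)"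
      unfolding N_def ab(3) by (rule four_block_mat_mult_vec[of _ m m _ m _ m])
        (use carr Mi(1) ab(1,2) in \<open>simp_all add: mult_carrier_mat[of _ m m]\<close>)
    then have "((\<xi> * Mi) *\<^sub>v a + 1\<^sub>m m *\<^sub>v b) @\<^sub>v (- 1\<^sub>m m *\<^sub>v a + 0\<^sub>m m m *\<^sub>v b) = 0\<^sub>v m @\<^sub>v 0\<^sub>v m"
      unfolding Nv append_vec_zero ..
    moreover have "(\<xi> * Mi) *\<^sub>v a + 1\<^sub>m m *\<^sub>v b \<in> carrier_vec m"
      by (rule carrier_vecI) (use ab(2) in simp)
    ultimately have 1: "(\<xi> * Mi) *\<^sub>v a + 1\<^sub>m m *\<^sub>v b = 0\<^sub>v m" and 2:
        "- 1\<^sub>m m *\<^sub>v a + 0\<^sub>m m m *\<^sub>v b = 0\<^sub>v m"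
      by (simp_all only: append_vec_eq[of _ m] zero_carrier_vec)
    have "0\<^sub>m m m *\<^sub>v b = 0\<^sub>v m"
      using ab(2) by (intro eq_vecI) auto
    then have "- a = 0\<^sub>v m"
      using 2 ab(1) by simp
    then have "a = 0\<^sub>v m"
      using ab(1) by (simp add: uminus_zero_vec_eq)
    then show ?thesis
      using 1 ab by (auto simp: append_vec_zero)
  qed
  then have "positive_definite M"
    unfolding M_def by (intro positive_definite_congruence[OF Dc Nc hD(2)])
  moreover have "W *\<^sub>v v = 0\<^sub>v (m + m) \<Longrightarrow> v = 0\<^sub>v (r + r)" if v: "v \<in> carrier_vec (r + r)" for v
  proof -
    assume Wv: "W *\<^sub>v v = 0\<^sub>v (m + m)"
    have "mat_adjoint W * W = 1\<^sub>m (r + r)"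
      unfolding adjW unfolding W_def using one by (simp add: block_diag_mult iso)
    then have "v = (mat_adjoint W * W) *\<^sub>v v"
      using v by simp
    also have "\<dots> = mat_adjoint W *\<^sub>v (W *\<^sub>v v)"
      using v by (intro mult_assoc_vec_dim) auto
    finally show ?thesis by (simp add: Wv)
  qed
  ultimately show "positive_definite A"
    unfolding A by (intro positive_definite_congruence[OF c(6) c(1)])
  have "v = 0\<^sub>v (r + r)" if v: "v \<in> carrier_vec (r + r)" "(\<i> \<cdot>\<^sub>m J) *\<^sub>v v = 0\<^sub>v (r + r)" for v
  proof -
    have Jd [simp]: "dim_row J = r + r" "dim_col J = r + r" by (simp_all add: J_def)
    have dv [simp]: "dim_vec v = r + r" using v(1) by simp
    have "(R * mat_adjoint (swap_mat r)) * J = R * (mat_adjoint (swap_mat r) * swap_mat r) * Ri"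
      unfolding J by (simp add: mult_assoc_dim)
    also have "\<dots> = 1\<^sub>m (r + r)"
      unfolding swap_mat_orthogonal using RRi c by simp
    finally have I: "(R * mat_adjoint (swap_mat r)) * J = 1\<^sub>m (r + r)" .
    have "\<i> \<cdot>\<^sub>v v = \<i> \<cdot>\<^sub>v (((R * mat_adjoint (swap_mat r)) * J) *\<^sub>v v)"
      unfolding I using v(1) by simp
    also have "\<dots> = (R * mat_adjoint (swap_mat r)) *\<^sub>v ((\<i> \<cdot>\<^sub>m J) *\<^sub>v v)"
      by (simp add: mult_assoc_vec_dim smult_vec_dim)
    also have "\<dots> = 0\<^sub>v (r + r)"
      unfolding v(2) by simp
    finally have "(- \<i>) \<cdot>\<^sub>v (\<i> \<cdot>\<^sub>v v) = (- \<i>) \<cdot>\<^sub>v 0\<^sub>v (r + r)" by simp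
    also have "\<dots> = 0\<^sub>v (r + r)" by (rule eq_vecI) auto
    finally show ?thesis by (simp add: smult_smult_assoc)
  qed
  moreover have Jc: "\<i> \<cdot>\<^sub>m J \<in> carrier_mat (r + r) (r + r)"
    unfolding J_def by auto
  ultimately show "mat_kernel (\<i> \<cdot>\<^sub>m J) = {0\<^sub>v (r + r)}"
    unfolding mat_kernel[OF Jc] by (auto simp: J_def)
qed

section \<open>Kronecker products\<close>

lemma dim_kronecker [simp]:
  "dim_row (A \<otimes>\<^sub>k B) = dim_row A * dim_row B" "dim_col (A \<otimes>\<^sub>k B) = dim_col A * dim_col B"
  by (simp_all add: kronecker_def)

lemma div_mod_bounds:
  assumes "i < a * (b :: nat)"
  shows "i div b < a" "i mod b < b"
  using assms by (cases "b = 0"; simp add: less_mult_imp_div_less)+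

lemma index_kronecker [simp]:
  assumes "i < dim_row A * dim_row B" "j < dim_col A * dim_col B"
  shows "(A \<otimes>\<^sub>k B) $$ (i, j)
    = A $$ (i div dim_row B, j div dim_col B) * B $$ (i mod dim_row B, j mod dim_col B)"
  using assms by (simp add: kronecker_def)

text \<open>Row-major enumeration of a grid by \<open>k = i * b + j\<close>.\<close>

lemma sum_div_mod:
  fixes f :: "nat \<Rightarrow> nat \<Rightarrow> 'a :: comm_monoid_add"
  shows "(\<Sum>k<a * b. f (k div b) (k mod b)) = (\<Sum>i<a. \<Sum>j<b. f i j)"
proof -
  have "(\<Sum>k = i * b..<i * b + b. f (k div b) (k mod b)) = (\<Sum>j<b. f i j)" for i
  proof -
    have "(\<Sum>k = i * b..<i * b + b. f (k div b) (k mod b))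
        = (\<Sum>j\<in>{0..<b}. f ((j + i * b) div b) ((j + i * b) mod b))"
      using sum.shift_bounds_nat_ivl[of "\<lambda>k. f (k div b) (k mod b)" 0 "i * b" b]
      by (simp add: add.commute)
    also have "\<dots> = (\<Sum>j<b. f i j)"
      by (intro sum.cong) auto
    finally show ?thesis .
  qed
  then show ?thesis
    using sum.nat_group[of "\<lambda>k. f (k div b) (k mod b)" b a] by simp
qed

lemma kronecker_mult:
  assumes "dim_col A = dim_row C" "dim_col B = dim_row D"
  shows "(A \<otimes>\<^sub>k B) * (C \<otimes>\<^sub>k D) = (A * C) \<otimes>\<^sub>k (B * D)"
proof (rule eq_matI)
  fix i j
  assume "i < dim_row ((A * C) \<otimes>\<^sub>k (B * D))" "j < dim_col ((A * C) \<otimes>\<^sub>k (B * D))"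
  then have ij: "i < dim_row A * dim_row B" "j < dim_col C * dim_col D" by auto
  note b = div_mod_bounds[OF ij(1)] div_mod_bounds[OF ij(2)]
  have "((A \<otimes>\<^sub>k B) * (C \<otimes>\<^sub>k D)) $$ (i, j)
      = (\<Sum>k<dim_row C * dim_row D. (A $$ (i div dim_row B, k div dim_row D) * B $$
          (i mod dim_row B, k mod dim_row D))
          * (C $$ (k div dim_row D, j div dim_col D) * D $$ (k mod dim_row D, j mod dim_col D)))"
    using ij assms by (simp add: scalar_prod_def lessThan_atLeast0)
  also have "\<dots> = (\<Sum>k<dim_row C. \<Sum>l<dim_row D. (A $$ (i div dim_row B, k)
      * B $$ (i mod dim_row B, l))
          * (C $$ (k, j div dim_col D) * D $$ (l, j mod dim_col D)))"
    by (rule sum_div_mod)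
  also have "\<dots> = (\<Sum>k<dim_row C. A $$ (i div dim_row B, k) * C $$ (k, j div dim_col D))
      * (\<Sum>l<dim_row D. B $$ (i mod dim_row B, l) * D $$ (l, j mod dim_col D))"
    by (simp add: sum_product mult_ac)
  also have "\<dots> = ((A * C) \<otimes>\<^sub>k (B * D)) $$ (i, j)"
    using ij b assms by (simp add: scalar_prod_def lessThan_atLeast0)
  finally show "((A \<otimes>\<^sub>k B) * (C \<otimes>\<^sub>k D)) $$ (i, j) = ((A * C) \<otimes>\<^sub>k (B * D)) $$ (i, j)" .
qed (use assms in auto)

lemma mat_adjoint_kronecker: "mat_adjoint (A \<otimes>\<^sub>k B) = mat_adjoint A \<otimes>\<^sub>k mat_adjoint B"
  by (rule eq_matI) (auto simp: div_mod_bounds)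

lemma mat_diag_dims [simp]: "dim_row (mat_diag n f) = n" "dim_col (mat_diag n f) = n"
  by (simp_all add: mat_diag_def)

lemma index_mat_diag [simp]:
  "i < n \<Longrightarrow> j < n \<Longrightarrow> mat_diag n f $$ (i, j) = (if i = j then f j else 0)"
  by (simp add: mat_diag_def)

lemma mat_diag_cong: "(\<And>i. i < n \<Longrightarrow> f i = g i) \<Longrightarrow> mat_diag n f = mat_diag n g"
  by (rule eq_matI) auto

lemma kronecker_mat_diag:
  "mat_diag m f \<otimes>\<^sub>k mat_diag n g = mat_diag (m * n) (\<lambda>i. f (i div n) * g (i mod n))"
  by (rule eq_matI) (auto simp: div_mod_bounds, metis div_mod_decomp)

lemma smult_mat_diag: "c \<cdot>\<^sub>m mat_diag n f = mat_diag n (\<lambda>i. c * (f i :: 'a :: semiring_0))"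
  by (rule eq_matI) auto

lemma add_mat_diag: "mat_diag n f + mat_diag n g = mat_diag n (\<lambda>i. f i + (g i :: 'a :: monoid_add))"
  by (rule eq_matI) auto

lemma minus_mat_diag: "mat_diag n f - mat_diag n g
    = mat_diag n (\<lambda>i. f i - (g i :: 'a :: group_add))"
  by (rule eq_matI) auto

section \<open>Fourier diagonalization of the difference operators\<close>

lemma cis_eq_1D:
  assumes "cis t = 1" "\<bar>t\<bar> < 2 * pi"
  shows "t = 0"
proof -
  have "cos t = 1"
    using arg_cong[OF assms(1), of Re] by simp
  then obtain k :: int where k: "t = of_int k * 2 * pi"
    using cos_one_2pi_int by auto
  have "\<bar>real_of_int k\<bar> < 1"
    using assms(2) by (simp add: k abs_mult)
  then show ?thesis by (simp add: k)
qed

text \<open>The phase advance of a Bloch wave between neighbouring grid points.\<close>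

definition phase :: "grid \<Rightarrow> real vec \<Rightarrow> nat \<Rightarrow> nat \<Rightarrow> real" where
  "phase G v m i = 2 * pi * (real i + wave G \<bullet> v) / real m"

lemma exp_phase: "exp (of_nat j * (\<theta>_idx m i + \<theta>_vec G v m)) = cis (real j * phase G v m i)"
  unfolding cis_conv_exp
  by (rule arg_cong[where f = exp])
      (simp add: \<theta>_idx_def \<theta>_vec_def phase_def add_divide_distrib algebra_simps)

text \<open>The Bloch waves of one coordinate direction, as columns.\<close>

definition W_mat :: "grid \<Rightarrow> real vec \<Rightarrow> nat \<Rightarrow> complex mat" where
  "W_mat G v m = mat m m (\<lambda>(j, i). exp (of_nat j * (\<theta>_idx m i + \<theta>_vec G v m)))"

lemma dim_W_mat [simp]: "dim_row (W_mat G v m) = m" "dim_col (W_mat G v m) = m"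
  by (simp_all add: W_mat_def)

lemma dim_basic_mats [simp]:
  "dim_row (K_mat G v m) = m" "dim_col (K_mat G v m) = m"
  "dim_row (D_mat G v m) = m" "dim_col (D_mat G v m) = m"
  "dim_row (U_mat m) = m" "dim_col (U_mat m) = m"
  "dim_row (\<Lambda>_mat G v m) = m" "dim_col (\<Lambda>_mat G v m) = m"
  by (simp_all add: K_mat_def D_mat_def U_mat_def \<Lambda>_mat_def)

lemma D_mult_U: "D_mat G v m * U_mat m = W_mat G v m"
  unfolding D_mat_def
  by (subst mat_diag_mult_left[of _ m m])
    (auto simp: U_mat_def W_mat_def exp_add[symmetric] algebra_simps)

text \<open>A Bloch wave is an eigenvector of the forward difference: in all rows but the last this
  is the geometric progression of its entries, and in the last row the corner entry of \<open>K\<close>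
  continues the progression across the period.\<close>

lemma K_mult_W:
  assumes "m \<ge> 2"
  shows "K_mat G v m * W_mat G v m = W_mat G v m * \<Lambda>_mat G v m"
proof (rule eq_matI)
  fix j i assume "j < dim_row (W_mat G v m * \<Lambda>_mat G v m)" "i < dim_col (W_mat G v m * \<Lambda>_mat G v m)"
  then have ij: "j < m" "i < m" by simp_all
  define e where "e = exp (\<i> * 2 * complex_of_real pi * complex_of_real (wave G \<bullet> v))"
  define z where "z = phase G v m i"
  have "real m * z = 2 * pi * real i + 2 * pi * (wave G \<bullet> v)"
    using assms by (simp add: z_def phase_def field_simps)
  then have "cis (real m * z) = cis (2 * pi * real i) * cis (2 * pi * (wave G \<bullet> v))"
    by (simp only: cis_mult)
  also have "cis (2 * pi * real i) = 1"
    by (rule cis_multiple_2pi) simp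
  finally have zm: "cis (real m * z) = e"
    by (simp add: e_def cis_conv_exp mult_ac)
  have "(K_mat G v m * W_mat G v m) $$ (j, i) = (\<Sum>l<m. K_mat G v m $$ (j, l) * cis (real l * z))"
    using ij by (simp add: scalar_prod_def lessThan_atLeast0 W_mat_def z_def exp_phase)
  also have "\<dots> = (\<Sum>l<m. (if l = j then - cis (real l * z) else 0)
      + (if l = (if j = m - 1 then 0 else j + 1) then (if j = m - 1 then e else 1) * cis
          (real l * z) else 0))"
    using ij assms by (intro sum.cong) (auto simp: K_mat_def e_def)
  also have "\<dots> = - cis (real j * z) + cis (real (Suc j) * z)"
    using ij assms zm by (auto simp: sum.distrib)
  also have "\<dots> = cis (real j * z) * (cis z - 1)"
    by (simp add: algebra_simps cis_mult)
  also have "\<dots> = (W_mat G v m * \<Lambda>_mat G v m) $$ (j, i)"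
    unfolding \<Lambda>_mat_def using ij exp_phase[of 1 m i G v]
    by (subst mat_diag_mult_right[of _ m m]) (auto simp: W_mat_def z_def exp_phase)
  finally show "(K_mat G v m * W_mat G v m) $$ (j, i) = (W_mat G v m * \<Lambda>_mat G v m) $$ (j, i)" .
qed auto

text \<open>The quasi-periodic factor has modulus 1 and cancels in the inner products, which are then
  the sums of the powers of an \<open>m\<close>-th root of unity.\<close>

lemma W_orthogonal:
  assumes "m > 0"
  shows "mat_adjoint (W_mat G v m) * W_mat G v m = mat_diag m (\<lambda>_. of_nat m)"
proof (rule eq_matI)
  fix i j assume "i < dim_row (mat_diag m (\<lambda>_. of_nat m :: complex))"
      "j < dim_col (mat_diag m (\<lambda>_. of_nat m :: complex))"
  then have ij: "i < m" "j < m" by simp_all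
  define t where "t = 2 * pi * (real j - real i) / real m"
  define r where "r = cis t"
  have "cnj (cis (real l * phase G v m i)) * cis (real l * phase G v m j) = r ^ l" for l
    unfolding r_def cis_cnj cis_mult Complex.DeMoivre
    by (rule arg_cong[where f = cis])
        (simp add: phase_def t_def diff_divide_distrib add_divide_distrib algebra_simps)
  then have "(mat_adjoint (W_mat G v m) * W_mat G v m) $$ (i, j) = (\<Sum>l<m. r ^ l)"
    using ij by (simp add: scalar_prod_def lessThan_atLeast0 W_mat_def exp_phase)
  also have "\<dots> = (if i = j then of_nat m else 0)"
  proof (cases "i = j")
    case True
    then show ?thesis by (simp add: r_def t_def)
  next
    case False
    have "r ^ m = cis (2 * pi * (real j - real i))"
      using assms by (simp add: r_def t_def Complex.DeMoivre)
    then have rm: "r ^ m = 1"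
      by (simp add: cis_multiple_2pi)
    have "\<bar>real j - real i\<bar> < real m" using ij by auto
    then have "2 * pi * (\<bar>real j - real i\<bar> / real m) < 2 * pi * 1"
      using assms by (intro mult_strict_left_mono) (auto simp: divide_less_eq)
    moreover have "\<bar>t\<bar> = 2 * pi * (\<bar>real j - real i\<bar> / real m)"
      by (simp add: t_def abs_mult abs_divide)
    ultimately have "\<bar>t\<bar> < 2 * pi" by simp
    moreover have "t \<noteq> 0" using False assms by (simp add: t_def)
    ultimately have "r \<noteq> 1"
      using cis_eq_1D unfolding r_def by blast
    then show ?thesis
      using False rm geometric_sum[of r m] by simp
  qed
  finally show "(mat_adjoint (W_mat G v m) * W_mat G v m) $$ (i, j)
      = mat_diag m (\<lambda>_. of_nat m) $$ (i, j)"
    using ij by simp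
qed auto

text \<open>The eigenvalues of the three difference operators. The position \<open>k\<close> in the Kronecker
  product encodes the mode \<open>(i\<^sub>1, i\<^sub>2, i\<^sub>3)\<close> by \<open>k = i\<^sub>3 n\<^sub>2 n\<^sub>1 + i\<^sub>2 n\<^sub>1 + i\<^sub>1\<close>.\<close>

definition freq\<^sub>1 :: "grid \<Rightarrow> nat \<Rightarrow> complex" where
  "freq\<^sub>1 G k = complex_of_real (inverse (\<delta>\<^sub>x G))
     * (cis (phase G (a\<^sub>1 G) (n\<^sub>1 G) (k mod (n\<^sub>2 G * n\<^sub>1 G) mod n\<^sub>1 G)) - 1)"

definition freq\<^sub>2 :: "grid \<Rightarrow> nat \<Rightarrow> complex" where
  "freq\<^sub>2 G k = complex_of_real (inverse (\<delta>\<^sub>y G))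
     * (cis (phase G (a\<^sub>2 G) (n\<^sub>2 G) (k mod (n\<^sub>2 G * n\<^sub>1 G) div n\<^sub>1 G)) - 1)"

definition freq\<^sub>3 :: "grid \<Rightarrow> nat \<Rightarrow> complex" where
  "freq\<^sub>3 G k = complex_of_real (inverse (\<delta>\<^sub>z G))
     * (cis (phase G (a\<^sub>3 G) (n\<^sub>3 G) (k div (n\<^sub>2 G * n\<^sub>1 G))) - 1)"

lemma \<Lambda>_mat_phase: "\<Lambda>_mat G v m = mat_diag m (\<lambda>i. cis (phase G v m i) - 1)"
  unfolding \<Lambda>_mat_def using exp_phase[of 1 m _ G v] by simp

lemma size_grid_eq: "n\<^sub>3 G * (n\<^sub>2 G * n\<^sub>1 G) = size_grid G"
  by (simp add: size_grid_def mult_ac)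

lemma \<Lambda>_diagonal:
  "\<Lambda>\<^sub>1 G = mat_diag (size_grid G) (freq\<^sub>1 G)"
  "\<Lambda>\<^sub>2 G = mat_diag (size_grid G) (freq\<^sub>2 G)"
  "\<Lambda>\<^sub>3 G = mat_diag (size_grid G) (freq\<^sub>3 G)"
proof -
  have one: "1\<^sub>m m = mat_diag m (\<lambda>_. 1 :: complex)" for m by simp
  show "\<Lambda>\<^sub>1 G = mat_diag (size_grid G) (freq\<^sub>1 G)"
    unfolding \<Lambda>\<^sub>1_def \<Lambda>_mat_phase one kronecker_mat_diag smult_mat_diag size_grid_eq
    by (rule mat_diag_cong) (simp only: freq\<^sub>1_def mult_1)
  show "\<Lambda>\<^sub>2 G = mat_diag (size_grid G) (freq\<^sub>2 G)"
    unfolding \<Lambda>\<^sub>2_def \<Lambda>_mat_phase one kronecker_mat_diag smult_mat_diag size_grid_eq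
    by (rule mat_diag_cong) (simp only: freq\<^sub>2_def mult_1 mult_1_right)
  show "\<Lambda>\<^sub>3 G = mat_diag (size_grid G) (freq\<^sub>3 G)"
    unfolding \<Lambda>\<^sub>3_def \<Lambda>_mat_phase one kronecker_mat_diag smult_mat_diag size_grid_eq
    by (rule mat_diag_cong) (simp only: freq\<^sub>3_def mult_1 mult_1_right)
qed

lemma T_mat_W: "T_mat G = complex_of_real (1 / sqrt (real (size_grid G))) \<cdot>\<^sub>m
    (W_mat G (a\<^sub>3 G) (n\<^sub>3 G) \<otimes>\<^sub>k W_mat G (a\<^sub>2 G) (n\<^sub>2 G) \<otimes>\<^sub>k W_mat G (a\<^sub>1 G) (n\<^sub>1 G))"
  unfolding T_mat_def by (simp add: kronecker_mult D_mult_U)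

lemma dim_T_mat [simp]: "dim_row (T_mat G) = size_grid G" "dim_col (T_mat G) = size_grid G"
  by (simp_all add: T_mat_W size_grid_eq)

lemma dim_curl_blocks [simp]:
  "dim_row (C\<^sub>1 G) = size_grid G" "dim_col (C\<^sub>1 G) = size_grid G"
  "dim_row (C\<^sub>2 G) = size_grid G" "dim_col (C\<^sub>2 G) = size_grid G"
  "dim_row (C\<^sub>3 G) = size_grid G" "dim_col (C\<^sub>3 G) = size_grid G"
  by (simp_all add: C\<^sub>1_def C\<^sub>2_def C\<^sub>3_def size_grid_eq)

lemma smult_mult_dim:
  fixes A B :: "'a :: comm_semiring_0 mat"
  assumes "dim_col A = dim_row B"
  shows "(c \<cdot>\<^sub>m A) * B = c \<cdot>\<^sub>m (A * B)" "A * (c \<cdot>\<^sub>m B) = c \<cdot>\<^sub>m (A * B)"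
  using assms by (auto intro!: eq_matI simp: scalar_prod_def sum_distrib_left ac_simps)

lemma T_unitary:
  assumes "n\<^sub>1 G > 0" "n\<^sub>2 G > 0" "n\<^sub>3 G > 0"
  shows "mat_adjoint (T_mat G) * T_mat G = 1\<^sub>m (size_grid G)"
proof -
  have pos: "size_grid G > 0" using assms by (simp add: size_grid_def)
  define c where "c = 1 / sqrt (real (size_grid G))"
  have c: "complex_of_real c * (complex_of_real c * of_nat (size_grid G)) = 1"
  proof -
    have "c * (c * real (size_grid G)) = 1"
      using pos by (simp add: c_def)
    then have "complex_of_real (c * (c * real (size_grid G))) = 1"
      by simp
    then show ?thesis
      by (simp only: of_real_mult of_real_of_nat_eq)
  qed
  define X where "X = W_mat G (a\<^sub>3 G) (n\<^sub>3 G) \<otimes>\<^sub>k W_mat G (a\<^sub>2 G) (n\<^sub>2 G)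
      \<otimes>\<^sub>k W_mat G (a\<^sub>1 G) (n\<^sub>1 G)"
  have "mat_adjoint X * X = mat_diag (n\<^sub>3 G) (\<lambda>_. of_nat (n\<^sub>3 G))
      \<otimes>\<^sub>k mat_diag (n\<^sub>2 G) (\<lambda>_. of_nat (n\<^sub>2 G)) \<otimes>\<^sub>k mat_diag (n\<^sub>1 G) (\<lambda>_. of_nat (n\<^sub>1 G))"
    unfolding X_def mat_adjoint_kronecker
    by (subst kronecker_mult, simp, simp)+
        (simp only: W_orthogonal[OF assms(1)] W_orthogonal[OF assms(2)] W_orthogonal[OF assms(3)])
  then have X: "mat_adjoint X * X
      = mat_diag (size_grid G) (\<lambda>_. of_nat (n\<^sub>3 G) * (of_nat (n\<^sub>2 G) * of_nat (n\<^sub>1 G)))"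
    by (simp only: kronecker_mat_diag size_grid_eq)
  have "mat_adjoint (T_mat G) * T_mat G
      = (complex_of_real c \<cdot>\<^sub>m mat_adjoint X) * (complex_of_real c \<cdot>\<^sub>m X)"
    unfolding T_mat_W c_def[symmetric] X_def[symmetric] by simp
  also have "\<dots> = complex_of_real c \<cdot>\<^sub>m (complex_of_real c \<cdot>\<^sub>m
      mat_diag (size_grid G) (\<lambda>_. of_nat (n\<^sub>3 G) * (of_nat (n\<^sub>2 G) * of_nat (n\<^sub>1 G))))"
    by (simp only: smult_mult_dim dim_mat_adjoint index_smult_mat X)
  also have "\<dots> = 1\<^sub>m (size_grid G)"
    unfolding smult_mat_diag mat_diag_one[symmetric]
    by (rule mat_diag_cong) (use c in \<open>simp add: size_grid_def mult_ac\<close>)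
  finally show ?thesis .
qed

lemma curl_block_diagonalization:
  assumes "n\<^sub>1 G \<ge> 2" "n\<^sub>2 G \<ge> 2" "n\<^sub>3 G \<ge> 2"
  shows "C\<^sub>1 G * T_mat G = T_mat G * \<Lambda>\<^sub>1 G"
    and "C\<^sub>2 G * T_mat G = T_mat G * \<Lambda>\<^sub>2 G"
    and "C\<^sub>3 G * T_mat G = T_mat G * \<Lambda>\<^sub>3 G"
proof -
  have one: "1\<^sub>m m * W_mat G v m = W_mat G v m" "W_mat G v m * 1\<^sub>m m = W_mat G v m" for v m
    by (auto intro: left_mult_one_mat right_mult_one_mat)
  have c: "a \<cdot>\<^sub>m (b \<cdot>\<^sub>m A) = b \<cdot>\<^sub>m (a \<cdot>\<^sub>m A)" for a b :: complex and A
    by (rule eq_matI) auto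
  show "C\<^sub>1 G * T_mat G = T_mat G * \<Lambda>\<^sub>1 G" "C\<^sub>2 G * T_mat G = T_mat G * \<Lambda>\<^sub>2 G"
      "C\<^sub>3 G * T_mat G = T_mat G * \<Lambda>\<^sub>3 G"
    unfolding T_mat_W C\<^sub>1_def C\<^sub>2_def C\<^sub>3_def \<Lambda>\<^sub>1_def \<Lambda>\<^sub>2_def \<Lambda>\<^sub>3_def
    by (simp_all add: smult_mult_dim kronecker_mult K_mult_W assms one c)
qed

section \<open>Block rows and columns\<close>

lemma dim_append [simp]:
  "dim_row (A @\<^sub>r B) = dim_row A + dim_row B" "dim_col (A @\<^sub>r B) = dim_col A"
  "dim_row (A @\<^sub>c B) = dim_row A" "dim_col (A @\<^sub>c B) = dim_col A + dim_col B"
  by (simp_all add: append_rows_def append_cols_def)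

lemma append_rows_mult:
  fixes A B M :: "complex mat"
  assumes "dim_col A = dim_row M" "dim_col B = dim_row M"
  shows "(A @\<^sub>r B) * M = A * M @\<^sub>r B * M"
proof -
  have "M = four_block_mat M (0\<^sub>m (dim_row M) 0) (0\<^sub>m 0 (dim_col M)) (0\<^sub>m 0 0)"
    by (rule eq_matI) auto
  then have "(A @\<^sub>r B) * M
      = (A @\<^sub>r B) * four_block_mat M (0\<^sub>m (dim_row M) 0) (0\<^sub>m 0 (dim_col M)) (0\<^sub>m 0 0)"
    by simp
  also have "\<dots> = A * M @\<^sub>r B * M"
    unfolding append_rows_def
    by (subst mult_four_block_mat[of _ "dim_row A" "dim_col A" _ 0 _ "dim_row B" _ _ "dim_col M" _
        0])
      (use assms in auto)
  finally show ?thesis .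
qed

lemma append_cols_mult_append_rows:
  fixes A B C D :: "complex mat"
  assumes "dim_col A = dim_row C" "dim_col B = dim_row D" "dim_row A = dim_row B"
      "dim_col C = dim_col D"
  shows "(A @\<^sub>c B) * (C @\<^sub>r D) = A * C + B * D"
proof -
  have "(A @\<^sub>c B) * (C @\<^sub>r D)
      = four_block_mat (A * C + B * D) (0\<^sub>m (dim_row A) 0) (0\<^sub>m 0 (dim_col C)) (0\<^sub>m 0 0)"
    unfolding append_rows_def append_cols_def
    by (subst mult_four_block_mat[of _ "dim_row A" "dim_col A" _ "dim_col B" _ 0 _ _ "dim_col C" _
        0])
      (use assms in auto)
  also have "\<dots> = A * C + B * D"
    by (rule eq_matI) (use assms in auto)
  finally show ?thesis .
qed

lemma append_cols_mult_block_diag: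
  fixes A B C D :: "complex mat"
  assumes "dim_col A = dim_row C" "dim_col B = dim_row D" "dim_row A = dim_row B"
  shows "(A @\<^sub>c B) * block_diag C D = A * C @\<^sub>c B * D"
  unfolding append_cols_def block_diag_def
  by (subst mult_four_block_mat[of _ "dim_row A" "dim_col A" _ "dim_col B" _ 0 _ _ "dim_col C" _
      "dim_col D"])
    (use assms in auto)

lemma append_rows_mult_append_cols:
  fixes A B C D :: "complex mat"
  assumes "dim_col A = dim_row C" "dim_col B = dim_row C" "dim_row C = dim_row D"
  shows "(A @\<^sub>r B) * (C @\<^sub>c D) = four_block_mat (A * C) (A * D) (B * C) (B * D)"
  unfolding append_cols_def append_rows_def
  by (subst mult_four_block_mat[of _ "dim_row A" "dim_col A" _ 0 _ "dim_row B" _ _ "dim_col C" _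
      "dim_col D"])
    (use assms in auto)

lemma mult_append_cols:
  fixes A C D :: "complex mat"
  assumes "dim_col A = dim_row C" "dim_row C = dim_row D"
  shows "A * (C @\<^sub>c D) = A * C @\<^sub>c A * D"
proof -
  have "A = four_block_mat A (0\<^sub>m (dim_row A) 0) (0\<^sub>m 0 (dim_col A)) (0\<^sub>m 0 0)"
    by (rule eq_matI) auto
  then have "A * (C @\<^sub>c D) = four_block_mat A (0\<^sub>m (dim_row A) 0) (0\<^sub>m 0 (dim_col A)) (0\<^sub>m 0 0)
      * (C @\<^sub>c D)"
    by simp
  also have "\<dots> = A * C @\<^sub>c A * D"
    unfolding append_cols_def
    by (subst mult_four_block_mat[of _ "dim_row A" "dim_col A" _ 0 _ 0 _ _ "dim_col C" _
        "dim_col D"])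
      (use assms in auto)
  finally show ?thesis .
qed

lemma mat_adjoint_append_rows:
  fixes A B :: "complex mat"
  assumes "dim_col A = dim_col B"
  shows "mat_adjoint (A @\<^sub>r B) = mat_adjoint A @\<^sub>c mat_adjoint B"
  unfolding append_cols_def append_rows_def
  by (subst mat_adjoint_four_block[of _ "dim_row A" "dim_col A" _ 0 _ "dim_row B"])
      (use assms in auto)

lemma mat_adjoint_append_cols:
  fixes A B :: "complex mat"
  assumes "dim_row A = dim_row B"
  shows "mat_adjoint (A @\<^sub>c B) = mat_adjoint A @\<^sub>r mat_adjoint B"
  unfolding append_cols_def append_rows_def
  by (subst mat_adjoint_four_block[of _ "dim_row A" "dim_col A" _ "dim_col B" _ 0])
      (use assms in auto)

lemma append_rows_add:
  fixes A B C D :: "complex mat"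
  assumes "dim_row A = dim_row C" "dim_row B = dim_row D" "dim_col A = dim_col B"
      "dim_col C = dim_col A" "dim_col D = dim_col A"
  shows "(A @\<^sub>r B) + (C @\<^sub>r D) = (A + C) @\<^sub>r (B + D)"
  by (rule eq_matI) (use assms in \<open>auto simp: append_rows_def\<close>)

lemma append_rows_minus:
  fixes A B C D :: "complex mat"
  assumes "dim_row A = dim_row C" "dim_row B = dim_row D" "dim_col A = dim_col B"
      "dim_col C = dim_col A" "dim_col D = dim_col A"
  shows "(A @\<^sub>r B) - (C @\<^sub>r D) = (A - C) @\<^sub>r (B - D)"
  by (rule eq_matI) (use assms in \<open>auto simp: append_rows_def\<close>)

lemma mult_distrib_dim:
  fixes A B C :: "'a :: ring mat"
  shows "dim_col A = dim_row B \<Longrightarrow> dim_row B = dim_row C \<Longrightarrow> dim_col B = dim_col C \<Longrightarrow> A * (B + C)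
      = A * B + A * C"
    and "dim_col A = dim_row B \<Longrightarrow> dim_row B = dim_row C \<Longrightarrow> dim_col B = dim_col C \<Longrightarrow> A * (B - C)
        = A * B - A * C"
    and "dim_col A = dim_row C \<Longrightarrow> dim_row A = dim_row B \<Longrightarrow> dim_col A = dim_col B \<Longrightarrow> (A - B) * C
        = A * C - B * C"
    and "dim_col A = dim_row B \<Longrightarrow> (- A) * B = - (A * B)"
  by (auto intro!: eq_matI simp: scalar_prod_def algebra_simps sum.distrib sum_subtractf sum_negf)

section \<open>Fields given by Fourier coefficients\<close>

text \<open>The \<open>k\<close>-th column is the vector field that has the Bloch wave in column \<open>k\<close> of \<open>T\<close> as its
  only mode, with the vector amplitude \<open>(f k, g k, h k)\<close>. All singular vectors below are of
  this form, so that the matrix identities between them become identities between vectors of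
  three complex numbers.\<close>

definition fourier_field ::
    "complex mat \<Rightarrow> (nat \<Rightarrow> complex) \<Rightarrow> (nat \<Rightarrow> complex) \<Rightarrow> (nat \<Rightarrow> complex) \<Rightarrow> complex mat" where
  "fourier_field T f g h = T * mat_diag (dim_col T) f @\<^sub>r T * mat_diag (dim_col T) g
      @\<^sub>r T * mat_diag (dim_col T) h"

lemma dim_fourier_field [simp]: "dim_row (fourier_field T f g h) = 3 * dim_row T"
    "dim_col (fourier_field T f g h) = dim_col T"
  by (simp_all add: fourier_field_def)

lemma fourier_field_cong:
  assumes "\<And>i. i < dim_col T \<Longrightarrow> f i = f' i \<and> g i = g' i \<and> h i = h' i"
  shows "fourier_field T f g h = fourier_field T f' g' h'"
  unfolding fourier_field_def using assms by (simp cong: mat_diag_cong)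

lemma fourier_field_mult_diag:
  "fourier_field T f g h * mat_diag (dim_col T) d
      = fourier_field T (\<lambda>i. f i * d i) (\<lambda>i. g i * d i) (\<lambda>i. h i * d i)"
  by (simp add: fourier_field_def append_rows_mult mult_assoc_dim)

lemma fourier_field_minus:
  "fourier_field T f g h - fourier_field T f' g' h'
      = fourier_field T (\<lambda>i. f i - f' i) (\<lambda>i. g i - g' i) (\<lambda>i. h i - h' i)"
  by (simp add: fourier_field_def append_rows_minus flip: minus_mat_diag mult_distrib_dim)

lemma isometry_cancel:
  assumes "mat_adjoint T * T = 1\<^sub>m (dim_col T)" "dim_row X = dim_col T"
  shows "mat_adjoint T * (T * X) = (X :: complex mat)"
proof -
  have "mat_adjoint T * (T * X) = (mat_adjoint T * T) * X"
    by (rule mult_assoc_dim[symmetric]) (simp_all add: assms(2))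
  then show ?thesis
    unfolding assms(1) using assms(2) by (simp add: left_mult_one_mat[OF carrier_matI])
qed

lemma fourier_field_gram:
  assumes "mat_adjoint T * T = 1\<^sub>m (dim_col T)"
  shows "mat_adjoint (fourier_field T f g h) * fourier_field T f' g' h'
    = mat_diag (dim_col T) (\<lambda>i. cnj (f i) * f' i + (cnj (g i) * g' i + cnj (h i) * h' i))"
  unfolding fourier_field_def
  by (simp add: mat_adjoint_append_rows append_cols_mult_append_rows mat_adjoint_mult mult_assoc_dim
      isometry_cancel[OF assms] add_mat_diag)

lemma kronecker_one_mult_field:
  assumes "dim_row T = n" "dim_col T = n" "n > 0"
  shows "(1\<^sub>m 3 \<otimes>\<^sub>k T) * fourier_field (1\<^sub>m n) f g h = fourier_field T f g h"
proof -
  have "1\<^sub>m 3 \<otimes>\<^sub>k T = (T @\<^sub>c 0\<^sub>m n n @\<^sub>c 0\<^sub>m n n) @\<^sub>r (0\<^sub>m n n @\<^sub>c T @\<^sub>c 0\<^sub>m n n)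
      @\<^sub>r (0\<^sub>m n n @\<^sub>c 0\<^sub>m n n @\<^sub>c T)"
  proof (rule eq_matI)
    fix i j
    assume "i < dim_row ((T @\<^sub>c 0\<^sub>m n n @\<^sub>c 0\<^sub>m n n) @\<^sub>r (0\<^sub>m n n @\<^sub>c T @\<^sub>c 0\<^sub>m n n)
        @\<^sub>r (0\<^sub>m n n @\<^sub>c 0\<^sub>m n n @\<^sub>c T))"
      and "j < dim_col ((T @\<^sub>c 0\<^sub>m n n @\<^sub>c 0\<^sub>m n n) @\<^sub>r (0\<^sub>m n n @\<^sub>c T @\<^sub>c 0\<^sub>m n n)
          @\<^sub>r (0\<^sub>m n n @\<^sub>c 0\<^sub>m n n @\<^sub>c T))"
    then have ij: "i < 3 * n" "j < 3 * n" using assms by auto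
    define p q where "p = i mod n" and "q = j mod n"
    have pq: "p < n" "q < n" using assms by (auto simp: p_def q_def)
    have block: "k = k mod n \<or> k = n + k mod n \<or> k = 2 * n + k mod n" if "k < 3 * n" for k
    proof -
      define q where "q = k div n"
      have "q < 3" using that by (simp add: q_def less_mult_imp_div_less)
      then have "q = 0 \<or> q = 1 \<or> q = 2" by linarith
      moreover have "q * n + k mod n = k" by (simp add: q_def)
      ultimately show ?thesis by (elim disjE) simp_all
    qed
    from block[OF ij(1)] block[OF ij(2)]
    have "i = p \<or> i = n + p \<or> i = 2 * n + p" "j = q \<or> j = n + q \<or> j = 2 * n + q"
      unfolding p_def q_def .
    then show "(1\<^sub>m 3 \<otimes>\<^sub>k T) $$ (i, j)
      = ((T @\<^sub>c 0\<^sub>m n n @\<^sub>c 0\<^sub>m n n) @\<^sub>r (0\<^sub>m n n @\<^sub>c T @\<^sub>c 0\<^sub>m n n) @\<^sub>r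
          (0\<^sub>m n n @\<^sub>c 0\<^sub>m n n @\<^sub>c T)) $$ (i, j)"
      using pq assms by (elim disjE) (simp_all add: append_rows_def append_cols_def)
  qed (use assms in auto)
  then show ?thesis
    using assms
    by (simp add: fourier_field_def append_rows_mult append_cols_mult_append_rows
        left_mult_one_mat[OF mat_diag_dim] left_mult_zero_mat[OF mat_diag_dim]
            left_add_zero_mat[OF carrier_matI] right_add_zero_mat[OF carrier_matI])
qed

text \<open>On amplitudes the curl is the cross product with \<open>(a, b, c)\<close>. For the adjoint, unitarity
  of \<open>T\<close> shows that the adjoint of each difference operator has the conjugate eigenvalues on
  the same modes.\<close>

lemma curl_mult_field:
  assumes "n\<^sub>1 G \<ge> 2" "n\<^sub>2 G \<ge> 2" "n\<^sub>3 G \<ge> 2"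
  defines "a \<equiv> freq\<^sub>1 G" and "b \<equiv> freq\<^sub>2 G" and "c \<equiv> freq\<^sub>3 G"
  shows "curl G * fourier_field (T_mat G) f g h
      = fourier_field (T_mat G) (\<lambda>i. b i * h i - c i * g i)
      (\<lambda>i. c i * f i - a i * h i) (\<lambda>i. a i * g i - b i * f i)"
    and "mat_adjoint (curl G) * fourier_field (T_mat G) f g h
        = fourier_field (T_mat G) (\<lambda>i. cnj (c i) * g i - cnj (b i) * h i)
      (\<lambda>i. cnj (a i) * h i - cnj (c i) * f i) (\<lambda>i. cnj (b i) * f i - cnj (a i) * g i)"
proof -
  define n where "n = size_grid G"
  define T where "T = T_mat G"
  have [simp]: "dim_row T = n" "dim_col T = n" "dim_row (C\<^sub>1 G) = n" "dim_col (C\<^sub>1 G) = n"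
    "dim_row (C\<^sub>2 G) = n" "dim_col (C\<^sub>2 G) = n" "dim_row (C\<^sub>3 G) = n" "dim_col (C\<^sub>3 G) = n"
    by (simp_all add: T_def n_def)
  have [simp]: "size_grid G = n" by (simp add: n_def)
  have unitary: "mat_adjoint T * T = 1\<^sub>m n"
    unfolding T_def n_def by (rule T_unitary) (use assms in auto)
  have unitary': "T * mat_adjoint T = 1\<^sub>m n"
    by (rule mat_mult_left_right_inverse[OF _ _ unitary]) (rule carrier_matI; simp)+
  have act: "X * (T * mat_diag n d) = T * mat_diag n (\<lambda>i. e i * d i)"
    and act_adj: "mat_adjoint X * (T * mat_diag n d) = T * mat_diag n (\<lambda>i. cnj (e i) * d i)"
    if [simp]: "dim_row X = n" "dim_col X = n" and XT: "X * T = T * mat_diag n e" for X d e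
  proof -
    have "X * (T * mat_diag n d) = (X * T) * mat_diag n d"
      by (rule mult_assoc_dim[symmetric]) simp_all
    then show "X * (T * mat_diag n d) = T * mat_diag n (\<lambda>i. e i * d i)"
      unfolding XT by (simp add: mult_assoc_dim)
    \<comment> \<open>The spectral decomposition of \<open>X\<close>, which can be conjugated.\<close>
    have "X = X * (T * mat_adjoint T)"
      unfolding unitary' by (simp add: right_mult_one_mat[OF carrier_matI])
    also have "\<dots> = (X * T) * mat_adjoint T"
      by (rule mult_assoc_dim[symmetric]) simp_all
    finally have X: "X = T * mat_diag n e * mat_adjoint T"
      unfolding XT .
    have "mat_adjoint X = T * (mat_diag n (\<lambda>i. cnj (e i)) * mat_adjoint T)"
      unfolding X by (simp add: mat_adjoint_mult)
    then show "mat_adjoint X * (T * mat_diag n d) = T * mat_diag n (\<lambda>i. cnj (e i) * d i)"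
      using unitary by (simp add: mult_assoc_dim isometry_cancel)
  qed
  note CT = curl_block_diagonalization[OF assms(1-3), folded T_def, unfolded \<Lambda>_diagonal, folded
      a_def b_def c_def n_def]
  note acts = act[OF _ _ CT(1)] act[OF _ _ CT(2)] act[OF _ _ CT(3)]
    act_adj[OF _ _ CT(1)] act_adj[OF _ _ CT(2)] act_adj[OF _ _ CT(3)]
  have neg: "- (T * mat_diag n d) = T * mat_diag n (\<lambda>i. - d i)" for d
    by (rule eq_matI) (auto simp: mat_diag_mult_right[of T n n] scalar_prod_def sum_negf[symmetric]
        intro!: sum.cong)
  have add: "T * mat_diag n d + T * mat_diag n e = T * mat_diag n (\<lambda>i. d i + e i)" for d e
    by (simp flip: add_mat_diag mult_distrib_dim)
  have zero: "0\<^sub>m n n * (T * mat_diag n d) = 0\<^sub>m n n" for d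
    by (simp add: left_mult_zero_mat[OF carrier_matI])
  have zadd: "0\<^sub>m n n + T * mat_diag n d = T * mat_diag n d"
      "T * mat_diag n d + 0\<^sub>m n n = T * mat_diag n d" for d
    by (simp_all add: left_add_zero_mat[OF carrier_matI] right_add_zero_mat[OF carrier_matI])
  note S = fourier_field_def append_rows_mult append_cols_mult_append_rows mult_distrib_dim(4) acts
      neg add zero zadd
  show "curl G * fourier_field T f g h = fourier_field T (\<lambda>i. b i * h i - c i * g i)
      (\<lambda>i. c i * f i - a i * h i) (\<lambda>i. a i * g i - b i * f i)"
    unfolding curl_def Let_def n_def[symmetric]
    by (simp add: S)
  have adj: "mat_adjoint (curl G) = (0\<^sub>m n n @\<^sub>r mat_adjoint (- C\<^sub>3 G) @\<^sub>r mat_adjoint (C\<^sub>2 G))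
      @\<^sub>c (mat_adjoint (C\<^sub>3 G) @\<^sub>r 0\<^sub>m n n @\<^sub>r mat_adjoint (- C\<^sub>1 G))
      @\<^sub>c (mat_adjoint (- C\<^sub>2 G) @\<^sub>r mat_adjoint (C\<^sub>1 G) @\<^sub>r 0\<^sub>m n n)"
    unfolding curl_def Let_def n_def[symmetric]
    by (simp add: mat_adjoint_append_rows mat_adjoint_append_cols)
  show "mat_adjoint (curl G) * fourier_field T f g h
      = fourier_field T (\<lambda>i. cnj (c i) * g i - cnj (b i) * h i)
      (\<lambda>i. cnj (a i) * h i - cnj (c i) * f i) (\<lambda>i. cnj (b i) * f i - cnj (a i) * g i)"
    unfolding adj by (simp add: S append_rows_add)
qed

section \<open>Nonvanishing of the symbols\<close>

text \<open>The phase lies in \<open>[0, 2 \<pi>)\<close>, because the Bloch component is at most a half and the mode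
  number is an integer below \<open>m\<close>; hence it is trivial only if both vanish.\<close>

lemma phase_eq_0:
  assumes "cis (phase G v m i) = 1" "i < m" "0 \<le> wave G \<bullet> v" "wave G \<bullet> v \<le> 1 / 2"
  shows "wave G \<bullet> v = 0"
proof -
  have "real i + wave G \<bullet> v < real m" using assms(2-4) by linarith
  then have "2 * pi * ((real i + wave G \<bullet> v) / real m) < 2 * pi * 1"
    using assms(2) by (intro mult_strict_left_mono) (auto simp: divide_less_eq)
  moreover have "phase G v m i \<ge> 0" using assms by (simp add: phase_def)
  ultimately have "\<bar>phase G v m i\<bar> < 2 * pi" by (simp add: phase_def)
  then have "phase G v m i = 0" by (rule cis_eq_1D[OF assms(1)])
  then show ?thesis using assms(2,3) by (simp add: phase_def)
qed

text \<open>If \<open>z - 1\<close> and \<open>z' - 1\<close> are real nonzero multiples of each other with \<open>|z| = |z'| = 1\<close>,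
  then \<open>z = z'\<close>: a line through 1 meets the unit circle in at most one other point.\<close>

lemma proportional_cis:
  assumes "complex_of_real d * (cis s - 1) = complex_of_real \<alpha> * (complex_of_real e * (cis t - 1))"
    and "d > 0" "e > 0" "\<alpha> \<noteq> 0" "cis t \<noteq> 1"
  shows "d = \<alpha> * e"
proof -
  define r where "r = \<alpha> * e / d"
  have "d * (cos s - 1) = \<alpha> * (e * (cos t - 1))" "d * sin s = \<alpha> * (e * sin t)"
    using arg_cong[OF assms(1), of Re] arg_cong[OF assms(1), of Im] by simp_all
  then have eq: "cos s = 1 + r * (cos t - 1)" "sin s = r * sin t"
    using assms(2) by (simp_all add: r_def field_simps)
  have "1 = (1 + r * (cos t - 1))\<^sup>2 + (r * sin t)\<^sup>2"
    using sin_cos_squared_add2[of s] unfolding eq by simp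
  also have "\<dots> = 1 + 2 * r * (r - 1) * (1 - cos t)"
  proof -
    have "(1 + r * (x - 1))\<^sup>2 + (r * y)\<^sup>2 = 1 + 2 * r * (r - 1) * (1 - x)" if "y\<^sup>2 = 1 - x\<^sup>2"
        for x y :: real
      unfolding power_mult_distrib that by (simp add: power2_eq_square algebra_simps)
    then show ?thesis using sin_squared_eq by blast
  qed
  finally have "r * (r - 1) * (1 - cos t) = 0" by simp
  moreover have "cos t \<noteq> 1"
  proof
    assume c: "cos t = 1"
    then have "sin t = 0" using sin_cos_squared_add[of t] by simp
    then show False using c assms(5) by (simp add: complex_eq_iff)
  qed
  moreover have "r \<noteq> 0" using assms by (simp add: r_def)
  ultimately have "r = 1" by simp
  then show ?thesis using assms by (simp add: r_def field_simps)
qed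

definition symbol_sq :: "grid \<Rightarrow> nat \<Rightarrow> real" where
  "symbol_sq G k = (cmod (freq\<^sub>1 G k))\<^sup>2 + (cmod (freq\<^sub>2 G k))\<^sup>2 + (cmod (freq\<^sub>3 G k))\<^sup>2"

text \<open>The squared norm of the cross product of the mode vector with \<open>(\<alpha>, \<beta>, 1)\<close>.\<close>

definition cross_sq :: "grid \<Rightarrow> real \<Rightarrow> real \<Rightarrow> nat \<Rightarrow> real" where
  "cross_sq G \<alpha> \<beta> k = (cmod (of_real \<beta> * freq\<^sub>3 G k - freq\<^sub>2 G k))\<^sup>2
     + ((cmod (freq\<^sub>1 G k - of_real \<alpha> * freq\<^sub>3 G k))\<^sup>2 +
         (cmod (of_real \<alpha> * freq\<^sub>2 G k - of_real \<beta> * freq\<^sub>1 G k))\<^sup>2)"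

lemma wave_lattice_vectors:
  assumes "wave G \<in> carrier_vec 3"
  shows "wave G \<bullet> a\<^sub>1 G = lattice_const G * wave G $ 0"
    and "wave G \<bullet> a\<^sub>2 G = lattice_const G * wave G $ 1"
    and "wave G \<bullet> a\<^sub>3 G = lattice_const G * wave G $ 2"
  using assms unfolding a\<^sub>1_def a\<^sub>2_def a\<^sub>3_def by simp_all

lemma symbol_sq_pos:
  assumes n: "n\<^sub>1 G \<ge> 2" "n\<^sub>2 G \<ge> 2" "n\<^sub>3 G \<ge> 2"
    and \<delta>: "\<delta>\<^sub>x G > 0" "\<delta>\<^sub>y G > 0" "\<delta>\<^sub>z G > 0" and a: "lattice_const G > 0"
    and w: "wave G \<in> carrier_vec 3" "wave G \<noteq> 0\<^sub>v 3"
    and bd: "\<And>l. l < 3 \<Longrightarrow> 0 \<le> wave G $ l \<and> wave G $ l \<le> 1 / (2 * lattice_const G)"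
    and k: "k < size_grid G"
  shows "symbol_sq G k > 0"
proof (rule ccontr)
  assume "\<not> symbol_sq G k > 0"
  then have "symbol_sq G k = 0" by (simp add: symbol_sq_def not_less antisym)
  then have z: "freq\<^sub>1 G k = 0" "freq\<^sub>2 G k = 0" "freq\<^sub>3 G k = 0"
    by (simp_all add: symbol_sq_def add_nonneg_eq_0_iff)
  have bd': "0 \<le> lattice_const G * wave G $ l" "lattice_const G * wave G $ l \<le> 1 / 2" if "l < 3"
      for l
    using bd[OF that] a by (auto simp: field_simps)
  note wl = wave_lattice_vectors[OF w(1)]
  have "k mod (n\<^sub>2 G * n\<^sub>1 G) < n\<^sub>2 G * n\<^sub>1 G" using n by simp
  from div_mod_bounds[OF this] have i: "k mod (n\<^sub>2 G * n\<^sub>1 G) mod n\<^sub>1 G < n\<^sub>1 G"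
      "k mod (n\<^sub>2 G * n\<^sub>1 G) div n\<^sub>1 G < n\<^sub>2 G"
    by simp_all
  have i3: "k div (n\<^sub>2 G * n\<^sub>1 G) < n\<^sub>3 G"
    using k div_mod_bounds(1)[of k "n\<^sub>3 G" "n\<^sub>2 G * n\<^sub>1 G"] by (simp add: size_grid_eq)
  have "wave G $ 0 = 0"
    using phase_eq_0[OF _ i(1), of G "a\<^sub>1 G"] z(1) \<delta> a bd'[of 0] by (simp add: freq\<^sub>1_def wl)
  moreover have "wave G $ 1 = 0"
    using phase_eq_0[OF _ i(2), of G "a\<^sub>2 G"] z(2) \<delta> a bd'[of 1] by (simp add: freq\<^sub>2_def wl)
  moreover have "wave G $ 2 = 0"
    using phase_eq_0[OF _ i3, of G "a\<^sub>3 G"] z(3) \<delta> a bd'[of 2] by (simp add: freq\<^sub>3_def wl)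
  ultimately have "wave G = 0\<^sub>v 3"
    using w(1) by (intro eq_vecI) (auto simp: less_Suc_eq numeral_3_eq_3 numeral_2_eq_2)
  then show False using w(2) by simp
qed

lemma cross_sq_pos:
  assumes q: "symbol_sq G k > 0" and \<delta>: "\<delta>\<^sub>x G > 0" "\<delta>\<^sub>y G > 0" "\<delta>\<^sub>z G > 0"
    and \<beta>: "\<beta> \<noteq> 0" "\<delta>\<^sub>z G \<noteq> \<beta> * \<delta>\<^sub>y G"
  shows "cross_sq G \<alpha> \<beta> k > 0"
proof (rule ccontr)
  assume "\<not> cross_sq G \<alpha> \<beta> k > 0"
  then have "cross_sq G \<alpha> \<beta> k = 0" by (simp add: cross_sq_def not_less antisym)
  then have z: "freq\<^sub>2 G k = of_real \<beta> * freq\<^sub>3 G k" "freq\<^sub>1 G k = of_real \<alpha> * freq\<^sub>3 G k"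
    by (simp_all add: cross_sq_def add_nonneg_eq_0_iff)
  have "freq\<^sub>3 G k \<noteq> 0"
    using q z by (auto simp: symbol_sq_def)
  then have "cis (phase G (a\<^sub>3 G) (n\<^sub>3 G) (k div (n\<^sub>2 G * n\<^sub>1 G))) \<noteq> 1"
    by (auto simp: freq\<^sub>3_def)
  then have "inverse (\<delta>\<^sub>y G) = \<beta> * inverse (\<delta>\<^sub>z G)"
    by (rule proportional_cis[OF z(1)[unfolded freq\<^sub>2_def freq\<^sub>3_def], rotated 3]) (use \<delta> \<beta> in auto)
  then show False using \<delta> \<beta> by (simp add: field_simps)
qed

section \<open>The singular value decomposition of the curl\<close>

lemma \<Lambda>\<^sub>q_diagonal: "\<Lambda>\<^sub>q G = mat_diag (size_grid G) (\<lambda>k. complex_of_real (symbol_sq G k))"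
  unfolding \<Lambda>\<^sub>q_def \<Lambda>_diagonal
  by (simp add: add_mat_diag, rule mat_diag_cong)
    (simp add: symbol_sq_def complex_norm_square[unfolded of_real_power] mult.commute)

lemma \<Lambda>\<^sub>p\<^sub>p_diagonal: "\<Lambda>\<^sub>p\<^sub>p G \<alpha> \<beta>
    = mat_diag (size_grid G) (\<lambda>k. complex_of_real (cross_sq G \<alpha> \<beta> k))"
proof -
  have one: "1\<^sub>m n * mat_diag n f = mat_diag n f" for n and f :: "nat \<Rightarrow> complex"
    by (rule left_mult_one_mat[OF mat_diag_dim])
  have "\<Lambda>\<^sub>p G \<alpha> \<beta> = fourier_field (1\<^sub>m (size_grid G)) (\<lambda>k. of_real \<beta> * freq\<^sub>3 G k - freq\<^sub>2 G k)
      (\<lambda>k. freq\<^sub>1 G k - of_real \<alpha> * freq\<^sub>3 G k)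
          (\<lambda>k. of_real \<alpha> * freq\<^sub>2 G k - of_real \<beta> * freq\<^sub>1 G k)"
    unfolding \<Lambda>\<^sub>p_def \<Lambda>_diagonal fourier_field_def by (simp add: smult_mat_diag minus_mat_diag one)
  then show ?thesis
    unfolding \<Lambda>\<^sub>p\<^sub>p_def
    by (simp add: fourier_field_gram, intro mat_diag_cong)
      (simp add: cross_sq_def complex_norm_square[unfolded of_real_power] mult.commute)
qed

lemma diag_powr_mat_diag:
  "diag_powr (mat_diag n (\<lambda>k. complex_of_real (x k))) s
      = mat_diag n (\<lambda>k. complex_of_real (x k powr s))"
  unfolding diag_powr_def by (simp, rule mat_diag_cong) simp

text \<open>Removing from each amplitude its component along \<open>(x, y, z)\<close>.\<close>

lemma fourier_field_projection:
  assumes "mat_adjoint T * T = 1\<^sub>m (dim_col T)"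
  shows "(1\<^sub>m (3 * dim_row T) - fourier_field T x y z * mat_adjoint (fourier_field T x y z))
      * fourier_field T f g h
    = fourier_field T
        (\<lambda>i. f i - x i * (cnj (x i) * f i + (cnj (y i) * g i + cnj (z i) * h i)))
        (\<lambda>i. g i - y i * (cnj (x i) * f i + (cnj (y i) * g i + cnj (z i) * h i)))
        (\<lambda>i. h i - z i * (cnj (x i) * f i + (cnj (y i) * g i + cnj (z i) * h i)))"
  by (simp add: mult_distrib_dim mult_assoc_dim fourier_field_gram[OF assms] fourier_field_mult_diag
      left_mult_one_mat[OF carrier_matI] fourier_field_minus)

text \<open>Orthonormality of the triple formed, for \<open>\<lambda> = (a, b, c)\<close>, \<open>t = (\<alpha>, \<beta>, 1)\<close> and \<open>r = |\<lambda>|\<close>,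
  by the normalized \<open>\<lambda>\<close>, the projection of \<open>t\<close> orthogonal to it, and the cross product of \<open>t\<close>
  with the conjugate of \<open>\<lambda>\<close>. Primed variables stand for complex conjugates, which makes the
  claims polynomial. The factor \<open>v\<close> is \<open>u\<close> or \<open>- u\<close>; the left singular vectors need the
  opposite sign.\<close>

lemma frame_identities:
  fixes a b c a' b' c' \<alpha> \<beta> r u v :: complex
  assumes rr: "r * r = a' * a + (b' * b + c' * c)" and r: "r \<noteq> 0"
    and uu: "u * u * ((\<beta> * c - b) * (\<beta> * c' - b')
        + ((a - \<alpha> * c) * (a' - \<alpha> * c') + (\<alpha> * b - \<beta> * a) * (\<alpha> * b' - \<beta> * a'))) = 1"
    and vv: "v * v = u * u"
  defines "s \<equiv> a' * \<alpha> + (b' * \<beta> + c')" and "s' \<equiv> a * \<alpha> + (b * \<beta> + c)"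
  shows "a' / r * (a / r) + (b' / r * (b / r) + c' / r * (c / r)) = 1"
    and "a' / r * ((\<alpha> - a * s / (r * r)) * (r * u)) + (b' / r * ((\<beta> - b * s / (r * r)) * (r * u))
        + c' / r * ((1 - c * s / (r * r)) * (r * u))) = 0"
    and "a' / r * ((c' * \<beta> - b') * v)
        + (b' / r * ((a' - c' * \<alpha>) * v) + c' / r * ((b' * \<alpha> - a' * \<beta>) * v)) = 0"
    and "((\<alpha> - a' * s' / (r * r)) * (r * u)) * ((\<alpha> - a * s / (r * r)) * (r * u))
      + (((\<beta> - b' * s' / (r * r)) * (r * u)) * ((\<beta> - b * s / (r * r)) * (r * u))
      + ((1 - c' * s' / (r * r)) * (r * u)) * ((1 - c * s / (r * r)) * (r * u))) = 1"
    and "((\<alpha> - a' * s' / (r * r)) * (r * u)) * ((c' * \<beta> - b') * v)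
      + (((\<beta> - b' * s' / (r * r)) * (r * u)) * ((a' - c' * \<alpha>) * v)
      + ((1 - c' * s' / (r * r)) * (r * u)) * ((b' * \<alpha> - a' * \<beta>) * v)) = 0"
    and "((c * \<beta> - b) * v) * ((c' * \<beta> - b') * v) + (((a - c * \<alpha>) * v) * ((a' - c' * \<alpha>) * v)
      + ((b * \<alpha> - a * \<beta>) * v) * ((b' * \<alpha> - a' * \<beta>) * v)) = 1"
proof -
  define w where "w = 1 / r"
  have w: "w * r = 1" using r by (simp add: w_def)
  have d: "x / (r * r) = x * w * w" "x / r = x * w" for x by (simp_all add: w_def)
  show "a' / r * (a / r) + (b' / r * (b / r) + c' / r * (c / r)) = 1"
    using r by (simp add: add_divide_distrib[symmetric] rr[symmetric])
  define S where "S = a' * a + (b' * b + c' * c)"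
  have wS: "w * w * S = 1"
  proof -
    have "w * w * S = (w * r) * (w * r)"
      unfolding S_def rr[symmetric] by (simp add: mult_ac)
    then show ?thesis by (simp add: w)
  qed
  show "a' / r * ((\<alpha> - a * s / (r * r)) * (r * u)) + (b' / r * ((\<beta> - b * s / (r * r)) * (r * u))
      + c' / r * ((1 - c * s / (r * r)) * (r * u))) = 0"
  proof -
    have "a' * w * ((\<alpha> - a * s * w * w) * (r * u))
        + (b' * w * ((\<beta> - b * s * w * w) * (r * u)) + c' * w * ((1 - c * s * w * w) * (r * u)))
        = w * r * u * (s - s * (w * w * S))"
      unfolding s_def S_def by (simp add: algebra_simps)
    then show ?thesis
      unfolding d wS by simp
  qed
  show "a' / r * ((c' * \<beta> - b') * v)
      + (b' / r * ((a' - c' * \<alpha>) * v) + c' / r * ((b' * \<alpha> - a' * \<beta>) * v)) = 0"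
    unfolding d by (simp add: algebra_simps)
  show "((\<alpha> - a' * s' / (r * r)) * (r * u)) * ((\<alpha> - a * s / (r * r)) * (r * u))
      + (((\<beta> - b' * s' / (r * r)) * (r * u)) * ((\<beta> - b * s / (r * r)) * (r * u))
      + ((1 - c' * s' / (r * r)) * (r * u)) * ((1 - c * s / (r * r)) * (r * u))) = 1"
  proof -
    define tt where "tt = \<alpha> * \<alpha> + \<beta> * \<beta> + 1"
    have "((\<alpha> - a' * s' * w * w) * (r * u)) * ((\<alpha> - a * s * w * w) * (r * u))
        + (((\<beta> - b' * s' * w * w) * (r * u)) * ((\<beta> - b * s * w * w) * (r * u))
        + ((1 - c' * s' * w * w) * (r * u)) * ((1 - c * s * w * w) * (r * u)))
      = u * u * ((r * r) * tt - (w * r) * (w * r) * (s * s') * (2 - w * w * S))"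
      unfolding s_def s'_def S_def tt_def by (simp add: algebra_simps)
    also have "\<dots> = u * u * (S * tt - s * s')"
      unfolding wS w rr S_def[symmetric] by simp
    \<comment> \<open>Lagrange's identity \<open>|\<lambda>|\<^sup>2 |t|\<^sup>2 - |\<lambda> \<cdot> t|\<^sup>2 = |\<lambda> \<times> t|\<^sup>2\<close>.\<close>
    also have "\<dots> = u * u * ((\<beta> * c - b) * (\<beta> * c' - b')
        + ((a - \<alpha> * c) * (a' - \<alpha> * c') + (\<alpha> * b - \<beta> * a) * (\<alpha> * b' - \<beta> * a')))"
      unfolding s_def s'_def S_def tt_def by (simp add: algebra_simps)
    finally show ?thesis
      unfolding d uu .
  qed
  show "((\<alpha> - a' * s' / (r * r)) * (r * u)) * ((c' * \<beta> - b') * v)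
      + (((\<beta> - b' * s' / (r * r)) * (r * u)) * ((a' - c' * \<alpha>) * v)
      + ((1 - c' * s' / (r * r)) * (r * u)) * ((b' * \<alpha> - a' * \<beta>) * v)) = 0"
    unfolding d s'_def by (simp add: algebra_simps)
  show "((c * \<beta> - b) * v) * ((c' * \<beta> - b') * v) + (((a - c * \<alpha>) * v) * ((a' - c' * \<alpha>) * v)
      + ((b * \<alpha> - a * \<beta>) * v) * ((b' * \<alpha> - a' * \<beta>) * v)) = 1"
  proof -
    have "((c * \<beta> - b) * v) * ((c' * \<beta> - b') * v) + (((a - c * \<alpha>) * v) * ((a' - c' * \<alpha>) * v)
        + ((b * \<alpha> - a * \<beta>) * v) * ((b' * \<alpha> - a' * \<beta>) * v))
      = (v * v) * ((\<beta> * c - b) * (\<beta> * c' - b') + ((a - \<alpha> * c) * (a' - \<alpha> * c') + (\<alpha> * b - \<beta> * a) *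
          (\<alpha> * b' - \<beta> * a')))"
      by (simp add: algebra_simps)
    then show ?thesis
      unfolding vv uu .
  qed
qed

text \<open>The orthonormal triple above in all modes at once: along \<open>(a, b, c)\<close>, along the
  projection of \<open>(\<alpha>, \<beta>, 1)\<close> orthogonal to it, and along the cross product of \<open>(\<alpha>, \<beta>, 1)\<close> with
  the conjugate of \<open>(a, b, c)\<close>.\<close>

definition longitudinal where
  "longitudinal T r a b c = fourier_field T (\<lambda>k. a k / r k) (\<lambda>k. b k / r k) (\<lambda>k. c k / r k)"

definition projected where
  "projected T \<alpha> \<beta> r u a b c = fourier_field T
     (\<lambda>k. (\<alpha> - a k * (cnj (a k) * \<alpha> + (cnj (b k) * \<beta> + cnj (c k))) / (r k * r k)) * (r k * u k))
     (\<lambda>k. (\<beta> - b k * (cnj (a k) * \<alpha> + (cnj (b k) * \<beta> + cnj (c k))) / (r k * r k)) * (r k * u k))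
     (\<lambda>k. (1 - c k * (cnj (a k) * \<alpha> + (cnj (b k) * \<beta> + cnj (c k))) / (r k * r k)) * (r k * u k))"

definition transverse where
  "transverse T \<alpha> \<beta> v a b c = fourier_field T
     (\<lambda>k. (cnj (c k) * \<beta> - cnj (b k)) * v k)
     (\<lambda>k. (cnj (a k) - cnj (c k) * \<alpha>) * v k)
     (\<lambda>k. (cnj (b k) * \<alpha> - cnj (a k) * \<beta>) * v k)"

lemma dim_frames [simp]:
  "dim_row (longitudinal T r a b c) = 3 * dim_row T" "dim_col (longitudinal T r a b c) = dim_col T"
  "dim_row (projected T \<alpha> \<beta> r u a b c) = 3 * dim_row T" "dim_col (projected T \<alpha> \<beta> r u a b c)
      = dim_col T"
  "dim_row (transverse T \<alpha> \<beta> v a b c) = 3 * dim_row T"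
      "dim_col (transverse T \<alpha> \<beta> v a b c) = dim_col T"
  by (simp_all add: longitudinal_def projected_def transverse_def)

lemma frame_orthonormal:
  fixes T :: "complex mat" and a b c :: "nat \<Rightarrow> complex" and r u v :: "nat \<Rightarrow> real" and \<alpha> \<beta> :: real
  defines "r' \<equiv> \<lambda>k. complex_of_real (r k)" and "u' \<equiv> \<lambda>k. complex_of_real (u k)" and
      "v' \<equiv> \<lambda>k. complex_of_real (v k)"
  defines "X \<equiv> longitudinal T r' a b c" and "Y \<equiv> projected T \<alpha> \<beta> r' u' a b c" and
      "Z \<equiv> transverse T \<alpha> \<beta> v' a b c"
  assumes T: "mat_adjoint T * T = 1\<^sub>m (dim_col T)"
    and rr: "\<And>k. k < dim_col T \<Longrightarrow> r k * r k = (cmod (a k))\<^sup>2 + (cmod (b k))\<^sup>2 + (cmod (c k))\<^sup>2"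
    and r: "\<And>k. k < dim_col T \<Longrightarrow> r k \<noteq> 0"
    and uu: "\<And>k. k < dim_col T \<Longrightarrow> u k * u k * ((cmod (of_real \<beta> * c k - b k))\<^sup>2
      + ((cmod (a k - of_real \<alpha> * c k))\<^sup>2 + (cmod (of_real \<alpha> * b k - of_real \<beta> * a k))\<^sup>2)) = 1"
    and vv: "\<And>k. k < dim_col T \<Longrightarrow> v k * v k = u k * u k"
  shows "mat_adjoint X * X = 1\<^sub>m (dim_col T)"
    and "mat_adjoint X * Y = 0\<^sub>m (dim_col T) (dim_col T)"
    and "mat_adjoint X * Z = 0\<^sub>m (dim_col T) (dim_col T)"
    and "mat_adjoint Y * Y = 1\<^sub>m (dim_col T)"
    and "mat_adjoint Y * Z = 0\<^sub>m (dim_col T) (dim_col T)"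
    and "mat_adjoint Z * Z = 1\<^sub>m (dim_col T)"
proof -
  have one: "1\<^sub>m (dim_col T) = mat_diag (dim_col T) (\<lambda>_. 1 :: complex)" by simp
  have zero: "0\<^sub>m (dim_col T) (dim_col T) = mat_diag (dim_col T) (\<lambda>_. 0 :: complex)"
    by (rule eq_matI) auto
  have sq: "(complex_of_real (cmod z))\<^sup>2 = z * cnj z" for z
    using complex_norm_square[of z] by simp
  have rr': "r' k * r' k = cnj (a k) * a k + (cnj (b k) * b k + cnj (c k) * c k)" if "k < dim_col T"
      for k
    using arg_cong[OF rr[OF that], of complex_of_real] unfolding r'_def
        by (simp add: sq mult.commute add.assoc)
  have uu': "u' k * u' k * ((of_real \<beta> * c k - b k) * (of_real \<beta> * cnj (c k) - cnj (b k))
      + ((a k - of_real \<alpha> * c k) * (cnj (a k) - of_real \<alpha> * cnj (c k))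
      + (of_real \<alpha> * b k - of_real \<beta> * a k) * (of_real \<alpha> * cnj (b k) - of_real \<beta> * cnj (a k)))) = 1"
    if "k < dim_col T" for k
    using arg_cong[OF uu[OF that], of complex_of_real] unfolding u'_def by (simp add: sq)
  have vv': "v' k * v' k = u' k * u' k" if "k < dim_col T" for k
    using vv[OF that] unfolding u'_def v'_def by (simp flip: of_real_mult)
  have r0: "r' k \<noteq> 0" if "k < dim_col T" for k
    using r[OF that] by (simp add: r'_def)
  have real [simp]: "cnj (r' k) = r' k" "cnj (u' k) = u' k" "cnj (v' k) = v' k" for k
    by (simp_all add: r'_def u'_def v'_def)
  note identities = frame_identities[OF rr' r0 uu' vv']
  note defs = X_def Y_def Z_def longitudinal_def projected_def transverse_def
    fourier_field_gram[OF T] one zero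
  show "mat_adjoint X * X = 1\<^sub>m (dim_col T)"
    unfolding defs using identities(1) by (intro mat_diag_cong) simp
  show "mat_adjoint X * Y = 0\<^sub>m (dim_col T) (dim_col T)"
    unfolding defs using identities(2) by (intro mat_diag_cong) simp
  show "mat_adjoint X * Z = 0\<^sub>m (dim_col T) (dim_col T)"
    unfolding defs using identities(3) by (intro mat_diag_cong) simp
  show "mat_adjoint Y * Y = 1\<^sub>m (dim_col T)"
    unfolding defs using identities(4) by (intro mat_diag_cong) simp
  show "mat_adjoint Y * Z = 0\<^sub>m (dim_col T) (dim_col T)"
    unfolding defs using identities(5) by (intro mat_diag_cong) simp
  show "mat_adjoint Z * Z = 1\<^sub>m (dim_col T)"
    unfolding defs using identities(6) by (intro mat_diag_cong) simp
qed

lemma powr_minus_half: "x > 0 \<Longrightarrow> x powr - (1/2) = 1 / sqrt x"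
  using powr_minus_divide[of x "1/2"] by (simp add: powr_half_sqrt)

lemma mult_mat_diag_const:
  "dim_col T = n \<Longrightarrow> T * mat_diag n (\<lambda>_. c) = c \<cdot>\<^sub>m (T :: complex mat)"
  by (subst mat_diag_mult_right[of T "dim_row T"]) (auto intro!: eq_matI)

definition sing_val :: "grid \<Rightarrow> nat \<Rightarrow> complex" where
  "sing_val G k = complex_of_real (sqrt (symbol_sq G k))"

definition cross_scale :: "grid \<Rightarrow> real \<Rightarrow> real \<Rightarrow> nat \<Rightarrow> complex" where
  "cross_scale G \<alpha> \<beta> k = complex_of_real (1 / sqrt (cross_sq G \<alpha> \<beta> k))"

lemma T\<^sub>1_field: "T\<^sub>1 G \<alpha> \<beta> = fourier_field (T_mat G) (\<lambda>_. of_real \<alpha>) (\<lambda>_. of_real \<beta>) (\<lambda>_. 1)"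
proof -
  have "1 \<cdot>\<^sub>m T_mat G = T_mat G" by (rule eq_matI) auto
  then show ?thesis
    unfolding T\<^sub>1_def fourier_field_def by (simp add: mult_mat_diag_const del: mat_diag_one)
qed

lemma \<Pi>\<^sub>0_field:
  assumes "\<And>k. k < size_grid G \<Longrightarrow> symbol_sq G k > 0"
  shows "\<Pi>\<^sub>0 G = longitudinal (1\<^sub>m (size_grid G)) (sing_val G) (freq\<^sub>1 G) (freq\<^sub>2 G) (freq\<^sub>3 G)"
proof -
  have one: "1\<^sub>m n * mat_diag n f = mat_diag n f" for n and f :: "nat \<Rightarrow> complex"
    by (rule left_mult_one_mat[OF mat_diag_dim])
  have "mat_diag (size_grid G) (\<lambda>k. complex_of_real (symbol_sq G k powr (- 1/2)))
      = mat_diag (size_grid G) (\<lambda>k. 1 / sing_val G k)"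
    by (rule mat_diag_cong) (use assms(1) in \<open>simp add: sing_val_def powr_minus_half\<close>)
  then have "\<Pi>\<^sub>0 G = fourier_field (1\<^sub>m (size_grid G)) (freq\<^sub>1 G) (freq\<^sub>2 G) (freq\<^sub>3 G)
      * mat_diag (size_grid G) (\<lambda>k. 1 / sing_val G k)"
    unfolding \<Pi>\<^sub>0_def \<Lambda>\<^sub>q_diagonal diag_powr_mat_diag \<Lambda>_diagonal fourier_field_def
        by (simp add: one)
  then show ?thesis
    using fourier_field_mult_diag[of "1\<^sub>m (size_grid G)"] by (simp add: longitudinal_def)
qed

lemma map_cnj_longitudinal:
  assumes "\<And>k. cnj (r k) = r k"
  shows "map_mat cnj (longitudinal (1\<^sub>m n) r a b c)
      = longitudinal (1\<^sub>m n) r (\<lambda>k. cnj (a k)) (\<lambda>k. cnj (b k)) (\<lambda>k. cnj (c k))"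
proof -
  have one: "1\<^sub>m n * mat_diag n f = mat_diag n f" for f :: "nat \<Rightarrow> complex"
    by (rule left_mult_one_mat[OF mat_diag_dim])
  have rows: "map_mat cnj (A @\<^sub>r B) = map_mat cnj A @\<^sub>r map_mat cnj B" if "dim_col A = dim_col B"
      for A B
    by (rule eq_matI) (use that in \<open>auto simp: append_rows_def\<close>)
  have diag: "map_mat cnj (mat_diag n f) = mat_diag n (\<lambda>k. cnj (f k))" for f
    by (rule eq_matI) auto
  show ?thesis
    unfolding longitudinal_def fourier_field_def by (simp add: one rows diag assms)
qed

lemma longitudinal_lift:
  assumes "dim_row T = n" "dim_col T = n" "n > 0"
  shows "(1\<^sub>m 3 \<otimes>\<^sub>k T) * longitudinal (1\<^sub>m n) r a b c = longitudinal T r a b c"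
  unfolding longitudinal_def using assms by (rule kronecker_one_mult_field)

lemma mat_inv_mat_diag:
  assumes "\<And>k. k < n \<Longrightarrow> f k \<noteq> 0"
  shows "mat_inv (mat_diag n f) = mat_diag n (\<lambda>k. 1 / f k)"
proof (rule mat_inv_eqI)
  show "mat_diag n f * mat_diag n (\<lambda>k. 1 / f k) = 1\<^sub>m n"
    unfolding mat_diag_diag mat_diag_one[symmetric] by (rule mat_diag_cong) (use assms in simp)
qed auto

text \<open>The defining formula of \<open>Q\<^sub>1\<close> and \<open>P\<^sub>1\<close> in terms of amplitudes.\<close>

lemma projected_cross_diag:
  assumes T: "mat_adjoint T * T = 1\<^sub>m (dim_col T)" and N: "dim_row T = N" "dim_col T = N"
    and real: "\<And>k. cnj (r k) = r k" "\<And>k. k < N \<Longrightarrow> r k \<noteq> 0"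
  shows "(1\<^sub>m (3 * N) - longitudinal T r a b c * mat_adjoint (longitudinal T r a b c))
      * fourier_field T (\<lambda>_. of_real \<alpha>) (\<lambda>_. of_real \<beta>) (\<lambda>_. 1) * mat_diag N (\<lambda>k. r k * u k)
    = projected T \<alpha> \<beta> r u a b c"
proof -
  have alg: "x / r k * (cnj (x' / r k) * y + (cnj (y' / r k) * z + cnj (z' / r k) * 1))
      = x * (cnj x' * y + (cnj y' * z + cnj z')) / (r k * r k)" if "k < N" for k x x' y y' z z'
    using real(2)[OF that] by (simp add: real(1) field_simps)
  show ?thesis
    unfolding longitudinal_def fourier_field_projection[OF T, unfolded N] projected_def
      fourier_field_mult_diag[of T, unfolded N]
    by (rule fourier_field_cong) (simp only: N alg)
qed

text \<open>From here on every mode vector is nonzero and not parallel to \<open>(\<alpha>, \<beta>, 1)\<close>. The right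
  singular vectors belong to the mode vectors and the left ones to their conjugates.\<close>

context
  fixes G :: grid and \<alpha> \<beta> :: real
  assumes n: "n\<^sub>1 G \<ge> 2" "n\<^sub>2 G \<ge> 2" "n\<^sub>3 G \<ge> 2"
    and q: "\<And>k. k < size_grid G \<Longrightarrow> symbol_sq G k > 0"
    and p: "\<And>k. k < size_grid G \<Longrightarrow> cross_sq G \<alpha> \<beta> k > 0"
begin

lemma size_grid_pos: "size_grid G > 0"
  using n by (simp add: size_grid_def)

lemma T_isometry: "mat_adjoint (T_mat G) * T_mat G = 1\<^sub>m (dim_col (T_mat G))"
  using T_unitary[of G] n by simp

lemma sing_val_real [simp]: "cnj (sing_val G k) = sing_val G k"
  by (simp add: sing_val_def)

lemma sing_val_nonzero: "k < size_grid G \<Longrightarrow> sing_val G k \<noteq> 0"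
  using q[of k] by (simp add: sing_val_def)

lemma Q\<^sub>0_eq: "Q\<^sub>0 G = longitudinal (T_mat G) (sing_val G) (freq\<^sub>1 G) (freq\<^sub>2 G) (freq\<^sub>3 G)"
proof -
  have \<Pi>: "\<Pi>\<^sub>0 G = longitudinal (1\<^sub>m (size_grid G)) (sing_val G) (freq\<^sub>1 G) (freq\<^sub>2 G) (freq\<^sub>3 G)"
    by (rule \<Pi>\<^sub>0_field) (rule q)
  show ?thesis
    unfolding Q\<^sub>0_def \<Pi> by (rule longitudinal_lift) (simp_all add: size_grid_pos)
qed

lemma P\<^sub>0_eq: "P\<^sub>0 G = longitudinal (T_mat G) (sing_val G)
    (\<lambda>k. cnj (freq\<^sub>1 G k)) (\<lambda>k. cnj (freq\<^sub>2 G k)) (\<lambda>k. cnj (freq\<^sub>3 G k))"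
proof -
  have \<Pi>: "\<Pi>\<^sub>0 G = longitudinal (1\<^sub>m (size_grid G)) (sing_val G) (freq\<^sub>1 G) (freq\<^sub>2 G) (freq\<^sub>3 G)"
    by (rule \<Pi>\<^sub>0_field) (rule q)
  show ?thesis
    unfolding P\<^sub>0_def \<Pi> map_cnj_longitudinal[OF sing_val_real]
    by (rule longitudinal_lift) (simp_all add: size_grid_pos)
qed

lemma scaling_eq: "diag_powr (\<Lambda>\<^sub>p\<^sub>p G \<alpha> \<beta> * mat_inv (\<Lambda>\<^sub>q G)) (- 1/2)
    = mat_diag (size_grid G) (\<lambda>k. sing_val G k * cross_scale G \<alpha> \<beta> k)"
proof -
  have inv: "mat_inv (\<Lambda>\<^sub>q G) = mat_diag (size_grid G) (\<lambda>k. 1 / complex_of_real (symbol_sq G k))"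
    unfolding \<Lambda>\<^sub>q_diagonal by (rule mat_inv_mat_diag) (use q in force)
  have "\<Lambda>\<^sub>p\<^sub>p G \<alpha> \<beta> * mat_inv (\<Lambda>\<^sub>q G)
      = mat_diag (size_grid G) (\<lambda>k. complex_of_real (cross_sq G \<alpha> \<beta> k / symbol_sq G k))"
    unfolding inv \<Lambda>\<^sub>p\<^sub>p_diagonal by simp
  then show ?thesis
    unfolding diag_powr_mat_diag
    by (simp add: diag_powr_mat_diag del: of_real_divide, intro mat_diag_cong)
      (use p q in \<open>simp add: powr_minus_half sing_val_def cross_scale_def real_sqrt_divide\<close>)
qed

lemma Q\<^sub>1_eq: "Q\<^sub>1 G \<alpha> \<beta> = projected (T_mat G) \<alpha> \<beta> (sing_val G) (cross_scale G \<alpha> \<beta>)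
    (freq\<^sub>1 G) (freq\<^sub>2 G) (freq\<^sub>3 G)"
  unfolding Q\<^sub>1_def Q\<^sub>0_eq T\<^sub>1_field scaling_eq
  by (rule projected_cross_diag[OF T_isometry]) (simp_all add: sing_val_nonzero)

lemma P\<^sub>1_eq: "P\<^sub>1 G \<alpha> \<beta> = projected (T_mat G) \<alpha> \<beta> (sing_val G) (cross_scale G \<alpha> \<beta>)
    (\<lambda>k. cnj (freq\<^sub>1 G k)) (\<lambda>k. cnj (freq\<^sub>2 G k)) (\<lambda>k. cnj (freq\<^sub>3 G k))"
  unfolding P\<^sub>1_def P\<^sub>0_eq T\<^sub>1_field scaling_eq
  by (rule projected_cross_diag[OF T_isometry]) (simp_all add: sing_val_nonzero)

lemma cross_scaling_eq:
    "diag_powr (\<Lambda>\<^sub>p\<^sub>p G \<alpha> \<beta>) (- 1/2) = mat_diag (size_grid G) (cross_scale G \<alpha> \<beta>)"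
  unfolding \<Lambda>\<^sub>p\<^sub>p_diagonal diag_powr_mat_diag
  by (rule mat_diag_cong) (use p in \<open>simp add: powr_minus_half cross_scale_def\<close>)

lemma Q\<^sub>2_eq: "Q\<^sub>2 G \<alpha> \<beta> = transverse (T_mat G) \<alpha> \<beta> (cross_scale G \<alpha> \<beta>)
    (freq\<^sub>1 G) (freq\<^sub>2 G) (freq\<^sub>3 G)"
  unfolding Q\<^sub>2_def T\<^sub>1_field cross_scaling_eq curl_mult_field[OF n] transverse_def
  using fourier_field_mult_diag[of "T_mat G"] by simp

lemma P\<^sub>2_eq: "P\<^sub>2 G \<alpha> \<beta> = transverse (T_mat G) \<alpha> \<beta> (\<lambda>k. - cross_scale G \<alpha> \<beta> k)
    (\<lambda>k. cnj (freq\<^sub>1 G k)) (\<lambda>k. cnj (freq\<^sub>2 G k)) (\<lambda>k. cnj (freq\<^sub>3 G k))"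
  unfolding P\<^sub>2_def T\<^sub>1_field cross_scaling_eq curl_mult_field[OF n] transverse_def
  using fourier_field_mult_diag[of "T_mat G"] by (simp add: algebra_simps)

lemma frame_scalars:
  assumes "k < size_grid G"
  shows "sqrt (symbol_sq G k) * sqrt (symbol_sq G k) = (cmod (freq\<^sub>1 G k))\<^sup>2 + (cmod (freq\<^sub>2 G k))\<^sup>2
      + (cmod (freq\<^sub>3 G k))\<^sup>2"
    and "sqrt (symbol_sq G k) \<noteq> 0"
    and "1 / sqrt (cross_sq G \<alpha> \<beta> k) * (1 / sqrt (cross_sq G \<alpha> \<beta> k)) *
      ((cmod (of_real \<beta> * freq\<^sub>3 G k - freq\<^sub>2 G k))\<^sup>2 +
          ((cmod (freq\<^sub>1 G k - of_real \<alpha> * freq\<^sub>3 G k))\<^sup>2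
        + (cmod (of_real \<alpha> * freq\<^sub>2 G k - of_real \<beta> * freq\<^sub>1 G k))\<^sup>2)) = 1"
proof -
  show "sqrt (symbol_sq G k) * sqrt (symbol_sq G k) = (cmod (freq\<^sub>1 G k))\<^sup>2 + (cmod (freq\<^sub>2 G k))\<^sup>2
      + (cmod (freq\<^sub>3 G k))\<^sup>2"
    using q[OF assms] by (simp add: symbol_sq_def)
  show "sqrt (symbol_sq G k) \<noteq> 0"
    using q[OF assms] by simp
  show "1 / sqrt (cross_sq G \<alpha> \<beta> k) * (1 / sqrt (cross_sq G \<alpha> \<beta> k)) *
      ((cmod (of_real \<beta> * freq\<^sub>3 G k - freq\<^sub>2 G k))\<^sup>2 +
          ((cmod (freq\<^sub>1 G k - of_real \<alpha> * freq\<^sub>3 G k))\<^sup>2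
        + (cmod (of_real \<alpha> * freq\<^sub>2 G k - of_real \<beta> * freq\<^sub>1 G k))\<^sup>2)) = 1"
    unfolding cross_sq_def[symmetric] using p[OF assms] by (simp add: field_simps)
qed

lemma sing_val_sq:
  assumes "k < size_grid G"
  shows "sing_val G k * sing_val G k = cnj (freq\<^sub>1 G k) * freq\<^sub>1 G k
    + (cnj (freq\<^sub>2 G k) * freq\<^sub>2 G k + cnj (freq\<^sub>3 G k) * freq\<^sub>3 G k)"
proof -
  have "(complex_of_real (cmod z))\<^sup>2 = z * cnj z" for z
    using complex_norm_square[of z] by simp
  then show ?thesis
    using arg_cong[OF frame_scalars(1)[OF assms], of complex_of_real]
    unfolding sing_val_def of_real_mult[symmetric] by (simp add: mult.commute add.assoc)
qed

lemma cmod_cnj_diff: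
  "cmod (complex_of_real x * cnj z - cnj y) = cmod (complex_of_real x * z - y)"
  "cmod (cnj y - complex_of_real x * cnj z) = cmod (y - complex_of_real x * z)"
  "cmod (complex_of_real x * cnj z - complex_of_real x' * cnj y)
      = cmod (complex_of_real x * z - complex_of_real x' * y)"
  using complex_mod_cnj[of "complex_of_real x * z - y"] complex_mod_cnj[of "y
      - complex_of_real x * z"]
    complex_mod_cnj[of "complex_of_real x * z - complex_of_real x' * y"] by simp_all

lemma right_frame:
  "mat_adjoint (Q\<^sub>0 G) * Q\<^sub>0 G = 1\<^sub>m (size_grid G)"
  "mat_adjoint (Q\<^sub>0 G) * Q\<^sub>1 G \<alpha> \<beta> = 0\<^sub>m (size_grid G) (size_grid G)"
  "mat_adjoint (Q\<^sub>0 G) * Q\<^sub>2 G \<alpha> \<beta> = 0\<^sub>m (size_grid G) (size_grid G)"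
  "mat_adjoint (Q\<^sub>1 G \<alpha> \<beta>) * Q\<^sub>1 G \<alpha> \<beta> = 1\<^sub>m (size_grid G)"
  "mat_adjoint (Q\<^sub>1 G \<alpha> \<beta>) * Q\<^sub>2 G \<alpha> \<beta> = 0\<^sub>m (size_grid G) (size_grid G)"
  "mat_adjoint (Q\<^sub>2 G \<alpha> \<beta>) * Q\<^sub>2 G \<alpha> \<beta> = 1\<^sub>m (size_grid G)"
proof -
  have lt: "k < size_grid G" if "k < dim_col (T_mat G)" for k using that by simp
  note F = frame_orthonormal[OF T_isometry frame_scalars(1)[OF lt] frame_scalars(2)[OF lt]
      frame_scalars(3)[OF lt] refl,
      folded sing_val_def cross_scale_def]
  show "mat_adjoint (Q\<^sub>0 G) * Q\<^sub>0 G = 1\<^sub>m (size_grid G)"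
    using F(1) unfolding Q\<^sub>0_eq by simp
  show "mat_adjoint (Q\<^sub>0 G) * Q\<^sub>1 G \<alpha> \<beta> = 0\<^sub>m (size_grid G) (size_grid G)"
    using F(2) unfolding Q\<^sub>0_eq Q\<^sub>1_eq by simp
  show "mat_adjoint (Q\<^sub>0 G) * Q\<^sub>2 G \<alpha> \<beta> = 0\<^sub>m (size_grid G) (size_grid G)"
    using F(3) unfolding Q\<^sub>0_eq Q\<^sub>2_eq by simp
  show "mat_adjoint (Q\<^sub>1 G \<alpha> \<beta>) * Q\<^sub>1 G \<alpha> \<beta> = 1\<^sub>m (size_grid G)"
    using F(4) unfolding Q\<^sub>1_eq by simp
  show "mat_adjoint (Q\<^sub>1 G \<alpha> \<beta>) * Q\<^sub>2 G \<alpha> \<beta> = 0\<^sub>m (size_grid G) (size_grid G)"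
    using F(5) unfolding Q\<^sub>1_eq Q\<^sub>2_eq by simp
  show "mat_adjoint (Q\<^sub>2 G \<alpha> \<beta>) * Q\<^sub>2 G \<alpha> \<beta> = 1\<^sub>m (size_grid G)"
    using F(6) unfolding Q\<^sub>2_eq by simp
qed

lemma left_frame:
  "mat_adjoint (P\<^sub>1 G \<alpha> \<beta>) * P\<^sub>1 G \<alpha> \<beta> = 1\<^sub>m (size_grid G)"
  "mat_adjoint (P\<^sub>1 G \<alpha> \<beta>) * P\<^sub>2 G \<alpha> \<beta> = 0\<^sub>m (size_grid G) (size_grid G)"
  "mat_adjoint (P\<^sub>2 G \<alpha> \<beta>) * P\<^sub>2 G \<alpha> \<beta> = 1\<^sub>m (size_grid G)"
proof -
  let ?a = "\<lambda>k. cnj (freq\<^sub>1 G k)" and ?b = "\<lambda>k. cnj (freq\<^sub>2 G k)" and ?c = "\<lambda>k. cnj (freq\<^sub>3 G k)"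
  let ?u = "\<lambda>k. 1 / sqrt (cross_sq G \<alpha> \<beta> k)"
  have lt: "k < size_grid G" if "k < dim_col (T_mat G)" for k using that by simp
  have 1: "sqrt (symbol_sq G k) * sqrt (symbol_sq G k) = (cmod (?a k))\<^sup>2 + (cmod (?b k))\<^sup>2
      + (cmod (?c k))\<^sup>2"
    if "k < dim_col (T_mat G)" for k
    using frame_scalars(1)[OF lt[OF that]] by simp
  have 2: "?u k * ?u k * ((cmod (of_real \<beta> * ?c k - ?b k))\<^sup>2 + ((cmod (?a k - of_real \<alpha> * ?c k))\<^sup>2
        + (cmod (of_real \<alpha> * ?b k - of_real \<beta> * ?a k))\<^sup>2)) = 1"
    if "k < dim_col (T_mat G)" for k
    unfolding cmod_cnj_diff by (rule frame_scalars(3)[OF lt[OF that]])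
  have 3: "(- ?u k) * (- ?u k) = ?u k * ?u k" if "k < dim_col (T_mat G)" for k
    by simp
  have neg: "complex_of_real (- ?u k) = - cross_scale G \<alpha> \<beta> k" for k
    by (simp add: cross_scale_def)
  note F = frame_orthonormal[OF T_isometry 1 frame_scalars(2)[OF lt] 2 3, unfolded neg, folded
      sing_val_def cross_scale_def]
  show "mat_adjoint (P\<^sub>1 G \<alpha> \<beta>) * P\<^sub>1 G \<alpha> \<beta> = 1\<^sub>m (size_grid G)"
    using F(4) unfolding P\<^sub>1_eq by simp
  show "mat_adjoint (P\<^sub>1 G \<alpha> \<beta>) * P\<^sub>2 G \<alpha> \<beta> = 0\<^sub>m (size_grid G) (size_grid G)"
    using F(5) unfolding P\<^sub>1_eq P\<^sub>2_eq by simp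
  show "mat_adjoint (P\<^sub>2 G \<alpha> \<beta>) * P\<^sub>2 G \<alpha> \<beta> = 1\<^sub>m (size_grid G)"
    using F(6) unfolding P\<^sub>2_eq by simp
qed

lemma dim_curl [simp]: "dim_row (curl G) = 3 * size_grid G" "dim_col (curl G) = 3 * size_grid G"
  by (simp_all add: curl_def Let_def)

lemma dim_singular_vectors [simp]:
  "dim_row (Q\<^sub>0 G) = 3 * size_grid G" "dim_col (Q\<^sub>0 G) = size_grid G"
  "dim_row (Q\<^sub>1 G \<alpha> \<beta>) = 3 * size_grid G" "dim_col (Q\<^sub>1 G \<alpha> \<beta>) = size_grid G"
  "dim_row (Q\<^sub>2 G \<alpha> \<beta>) = 3 * size_grid G" "dim_col (Q\<^sub>2 G \<alpha> \<beta>) = size_grid G"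
  "dim_row (P\<^sub>1 G \<alpha> \<beta>) = 3 * size_grid G" "dim_col (P\<^sub>1 G \<alpha> \<beta>) = size_grid G"
  "dim_row (P\<^sub>2 G \<alpha> \<beta>) = 3 * size_grid G" "dim_col (P\<^sub>2 G \<alpha> \<beta>) = size_grid G"
  by (simp_all add: Q\<^sub>0_eq Q\<^sub>1_eq Q\<^sub>2_eq P\<^sub>1_eq P\<^sub>2_eq)

text \<open>The three cases are \<open>\<lambda> \<times> \<lambda> = 0\<close>, the fact that the projection changes \<open>t\<close> by a multiple
  of \<open>\<lambda>\<close> only, and the expansion of the double cross product \<open>\<lambda> \<times> (t \<times> \<lambda>')\<close>, where \<open>\<lambda>'\<close> is the
  conjugate of \<open>\<lambda>\<close>.\<close>

lemma curl_singular_vectors: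
  "curl G * Q\<^sub>0 G = 0\<^sub>m (3 * size_grid G) (size_grid G)"
  "curl G * Q\<^sub>1 G \<alpha> \<beta> = P\<^sub>2 G \<alpha> \<beta> * mat_diag (size_grid G) (sing_val G)"
  "curl G * Q\<^sub>2 G \<alpha> \<beta> = P\<^sub>1 G \<alpha> \<beta> * mat_diag (size_grid G) (sing_val G)"
proof -
  define N where "N = size_grid G"
  have zero: "fourier_field (T_mat G) (\<lambda>_. 0) (\<lambda>_. 0) (\<lambda>_. 0) = 0\<^sub>m (3 * N) N"
  proof -
    have z: "T_mat G * mat_diag N (\<lambda>_. 0) = 0\<^sub>m N N"
      by (subst mult_mat_diag_const) (auto simp: N_def intro!: eq_matI)
    show ?thesis
      unfolding fourier_field_def dim_T_mat N_def[symmetric] z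
      by (rule eq_matI) (auto simp: append_rows_def)
  qed
  show "curl G * Q\<^sub>0 G = 0\<^sub>m (3 * size_grid G) (size_grid G)"
    unfolding Q\<^sub>0_eq longitudinal_def curl_mult_field[OF n]
        by (simp add: zero[unfolded N_def] mult.commute)
  show "curl G * Q\<^sub>1 G \<alpha> \<beta> = P\<^sub>2 G \<alpha> \<beta> * mat_diag (size_grid G) (sing_val G)"
    unfolding Q\<^sub>1_eq P\<^sub>2_eq projected_def transverse_def curl_mult_field[OF n]
      fourier_field_mult_diag[of "T_mat G", unfolded dim_T_mat]
    by (rule fourier_field_cong) (simp add: algebra_simps)
  show "curl G * Q\<^sub>2 G \<alpha> \<beta> = P\<^sub>1 G \<alpha> \<beta> * mat_diag (size_grid G) (sing_val G)"
    unfolding Q\<^sub>2_eq P\<^sub>1_eq projected_def transverse_def curl_mult_field[OF n]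
      fourier_field_mult_diag[of "T_mat G", unfolded dim_T_mat]
  proof (rule fourier_field_cong, unfold dim_T_mat complex_cnj_cnj, intro conjI)
    fix k assume k: "k < size_grid G"
    let ?a = "freq\<^sub>1 G k" and ?b = "freq\<^sub>2 G k" and ?c = "freq\<^sub>3 G k" and ?r = "sing_val G k"
        and ?u = "cross_scale G \<alpha> \<beta> k"
    have rr: "?r * ?r = cnj ?a * ?a + (cnj ?b * ?b + cnj ?c * ?c)" and r: "?r \<noteq> 0"
      using sing_val_sq[OF k] sing_val_nonzero[OF k] by simp_all
    have rem: "(x - y * s / (?r * ?r)) * (?r * ?u) * ?r = (x * (?r * ?r) - y * s) * ?u" for x y s
      using r by (simp add: field_simps)
    show "?b * ((cnj ?b * of_real \<alpha> - cnj ?a * of_real \<beta>) * ?u)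
        - ?c * ((cnj ?a - cnj ?c * of_real \<alpha>) * ?u)
      = (of_real \<alpha> - cnj ?a * (?a * of_real \<alpha> + (?b * of_real \<beta> + ?c)) / (?r * ?r)) *
          (?r * ?u) * ?r"
      unfolding rem unfolding rr by (simp add: algebra_simps)
    show "?c * ((cnj ?c * of_real \<beta> - cnj ?b) * ?u)
        - ?a * ((cnj ?b * of_real \<alpha> - cnj ?a * of_real \<beta>) * ?u)
      = (of_real \<beta> - cnj ?b * (?a * of_real \<alpha> + (?b * of_real \<beta> + ?c)) / (?r * ?r)) *
          (?r * ?u) * ?r"
      unfolding rem unfolding rr by (simp add: algebra_simps)
    show "?a * ((cnj ?a - cnj ?c * of_real \<alpha>) * ?u) - ?b * ((cnj ?c * of_real \<beta> - cnj ?b) * ?u)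
      = (1 - cnj ?c * (?a * of_real \<alpha> + (?b * of_real \<beta> + ?c)) / (?r * ?r)) * (?r * ?u) * ?r"
      unfolding rem unfolding rr by (simp add: algebra_simps)
  qed
qed

lemma \<Sigma>\<^sub>r_eq: "\<Sigma>\<^sub>r G = block_diag (mat_diag (size_grid G) (sing_val G))
    (mat_diag (size_grid G) (sing_val G))"
proof -
  have "diag_powr (\<Lambda>\<^sub>q G) (1/2) = mat_diag (size_grid G) (sing_val G)"
    unfolding \<Lambda>\<^sub>q_diagonal diag_powr_mat_diag
    by (rule mat_diag_cong) (use q in \<open>simp add: powr_half_sqrt sing_val_def less_imp_le\<close>)
  then show ?thesis
    unfolding \<Sigma>\<^sub>r_def by (simp only: diag_block_mat_pair)
qed

lemma adjoint_zero_product: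
  fixes A B :: "complex mat"
  assumes "mat_adjoint A * B = 0\<^sub>m m k" "dim_row A = dim_row B"
  shows "mat_adjoint B * A = 0\<^sub>m k m"
proof -
  have "mat_adjoint B * A = mat_adjoint (mat_adjoint A * B)"
    using assms(2) by (simp add: mat_adjoint_mult)
  then show ?thesis unfolding assms(1) by simp
qed

lemma singular_vectors_isometry:
  "mat_adjoint (P\<^sub>r G \<alpha> \<beta>) * P\<^sub>r G \<alpha> \<beta> = 1\<^sub>m (2 * size_grid G)"
  "mat_adjoint (Q\<^sub>r G \<alpha> \<beta>) * Q\<^sub>r G \<alpha> \<beta> = 1\<^sub>m (2 * size_grid G)"
proof -
  have "mat_adjoint (P\<^sub>2 G \<alpha> \<beta>) * P\<^sub>1 G \<alpha> \<beta> = 0\<^sub>m (size_grid G) (size_grid G)"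
    by (rule adjoint_zero_product[OF left_frame(2)]) simp
  then show "mat_adjoint (P\<^sub>r G \<alpha> \<beta>) * P\<^sub>r G \<alpha> \<beta> = 1\<^sub>m (2 * size_grid G)"
    unfolding P\<^sub>r_def by (simp add: mat_adjoint_append_cols append_rows_mult_append_cols left_frame
        mult_2)
  have "mat_adjoint (Q\<^sub>2 G \<alpha> \<beta>) * Q\<^sub>1 G \<alpha> \<beta> = 0\<^sub>m (size_grid G) (size_grid G)"
    by (rule adjoint_zero_product[OF right_frame(5)]) simp
  then show "mat_adjoint (Q\<^sub>r G \<alpha> \<beta>) * Q\<^sub>r G \<alpha> \<beta> = 1\<^sub>m (2 * size_grid G)"
    unfolding Q\<^sub>r_def by (simp add: mat_adjoint_append_cols append_rows_mult_append_cols right_frame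
        mult_2)
qed

lemma dim_PQ [simp]:
  "dim_row (P\<^sub>r G \<alpha> \<beta>) = 3 * size_grid G" "dim_col (P\<^sub>r G \<alpha> \<beta>) = 2 * size_grid G"
  "dim_row (Q\<^sub>r G \<alpha> \<beta>) = 3 * size_grid G" "dim_col (Q\<^sub>r G \<alpha> \<beta>) = 2 * size_grid G"
  "dim_row (\<Sigma>\<^sub>r G) = 2 * size_grid G" "dim_col (\<Sigma>\<^sub>r G) = 2 * size_grid G"
  by (simp_all add: P\<^sub>r_def Q\<^sub>r_def \<Sigma>\<^sub>r_eq)

text \<open>The \<open>3 n\<close> columns of \<open>Q\<^sub>0\<close> and \<open>Q\<^sub>r\<close> are orthonormal, so that they form a square
  isometry, which is unitary.\<close>

lemma right_singular_vectors_complete: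
  "Q\<^sub>0 G * mat_adjoint (Q\<^sub>0 G) + Q\<^sub>r G \<alpha> \<beta> * mat_adjoint (Q\<^sub>r G \<alpha> \<beta>) = 1\<^sub>m (3 * size_grid G)"
proof -
  define N where "N = size_grid G"
  define X where "X = Q\<^sub>0 G @\<^sub>c Q\<^sub>r G \<alpha> \<beta>"
  have X: "X \<in> carrier_mat (3 * N) (3 * N)"
    by (rule carrier_matI) (simp_all add: X_def N_def)
  have "0\<^sub>m N N @\<^sub>c 0\<^sub>m N N = 0\<^sub>m N (2 * N)"
    by (rule eq_matI) (auto simp: append_cols_def)
  then have Q0r: "mat_adjoint (Q\<^sub>0 G) * Q\<^sub>r G \<alpha> \<beta> = 0\<^sub>m N (2 * N)"
    unfolding Q\<^sub>r_def by (simp add: mult_append_cols right_frame N_def)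
  have Qr0: "mat_adjoint (Q\<^sub>r G \<alpha> \<beta>) * Q\<^sub>0 G = 0\<^sub>m (2 * N) N"
    by (rule adjoint_zero_product[OF Q0r]) simp
  have "mat_adjoint X * X = four_block_mat (1\<^sub>m N) (0\<^sub>m N (2 * N)) (0\<^sub>m (2 * N) N) (1\<^sub>m (2 * N))"
    unfolding X_def by (simp add: mat_adjoint_append_cols append_rows_mult_append_cols
        right_frame(1)
        singular_vectors_isometry Q0r Qr0 flip: N_def)
  then have XX: "mat_adjoint X * X = 1\<^sub>m (3 * N)"
    by simp
  have "X * mat_adjoint X = 1\<^sub>m (3 * N)"
    by (rule mat_mult_left_right_inverse[OF _ X XX]) (use X in auto)
  then show ?thesis
    unfolding X_def by (simp add: mat_adjoint_append_cols append_cols_mult_append_rows N_def)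
qed

text \<open>Expand the identity by completeness; the kernel part \<open>Q\<^sub>0\<close> drops out.\<close>

lemma curl_svd: "curl G = P\<^sub>r G \<alpha> \<beta> * \<Sigma>\<^sub>r G * mat_adjoint (Q\<^sub>r G \<alpha> \<beta>)"
proof -
  have CQ: "curl G * Q\<^sub>r G \<alpha> \<beta> = P\<^sub>r G \<alpha> \<beta> * \<Sigma>\<^sub>r G"
    unfolding Q\<^sub>r_def P\<^sub>r_def \<Sigma>\<^sub>r_eq
    by (simp add: mult_append_cols append_cols_mult_block_diag curl_singular_vectors)
  have "curl G = curl G * 1\<^sub>m (3 * size_grid G)"
    by (simp add: right_mult_one_mat[OF carrier_matI])
  also have "\<dots> = (curl G * Q\<^sub>0 G) * mat_adjoint (Q\<^sub>0 G)
      + (curl G * Q\<^sub>r G \<alpha> \<beta>) * mat_adjoint (Q\<^sub>r G \<alpha> \<beta>)"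
    unfolding right_singular_vectors_complete[symmetric]
        by (simp add: mult_distrib_dim mult_assoc_dim)
  also have "(curl G * Q\<^sub>0 G) * mat_adjoint (Q\<^sub>0 G) = 0\<^sub>m (3 * size_grid G) (3 * size_grid G)"
    unfolding curl_singular_vectors by (rule left_mult_zero_mat) (rule carrier_matI; simp)
  also have "0\<^sub>m (3 * size_grid G) (3 * size_grid G)
      + (curl G * Q\<^sub>r G \<alpha> \<beta>) * mat_adjoint (Q\<^sub>r G \<alpha> \<beta>)
      = (curl G * Q\<^sub>r G \<alpha> \<beta>) * mat_adjoint (Q\<^sub>r G \<alpha> \<beta>)"
    by (rule left_add_zero_mat) (rule carrier_matI; simp)
  finally show ?thesis unfolding CQ .
qed

lemma \<Sigma>\<^sub>r_inverse:
  "\<Sigma>\<^sub>r G * mat_inv (\<Sigma>\<^sub>r G) = 1\<^sub>m (2 * size_grid G)"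
  "mat_inv (\<Sigma>\<^sub>r G) \<in> carrier_mat (2 * size_grid G) (2 * size_grid G)"
proof -
  define D where "D = mat_diag (size_grid G) (\<lambda>k. 1 / sing_val G k)"
  have "mat_diag (size_grid G) (sing_val G) * D = 1\<^sub>m (size_grid G)"
    unfolding D_def mat_diag_diag mat_diag_one[symmetric]
        by (rule mat_diag_cong) (simp add: sing_val_nonzero)
  then have "\<Sigma>\<^sub>r G * block_diag D D = block_diag (1\<^sub>m (size_grid G)) (1\<^sub>m (size_grid G))"
    unfolding \<Sigma>\<^sub>r_eq by (subst block_diag_mult) (simp_all add: D_def)
  then have I: "\<Sigma>\<^sub>r G * block_diag D D = 1\<^sub>m (2 * size_grid G)"
    by (simp add: block_diag_def mult_2)
  have c: "block_diag D D \<in> carrier_mat (2 * size_grid G) (2 * size_grid G)"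
    by (rule carrier_matI) (simp_all add: D_def)
  have "mat_inv (\<Sigma>\<^sub>r G) = block_diag D D"
    by (rule mat_inv_eqI[OF _ c I]) (rule carrier_matI; simp)
  then show "\<Sigma>\<^sub>r G * mat_inv (\<Sigma>\<^sub>r G) = 1\<^sub>m (2 * size_grid G)"
    "mat_inv (\<Sigma>\<^sub>r G) \<in> carrier_mat (2 * size_grid G) (2 * size_grid G)"
    using I c by simp_all
qed

lemma \<Sigma>\<^sub>r_hermitian: "mat_adjoint (\<Sigma>\<^sub>r G) = \<Sigma>\<^sub>r G"
  unfolding \<Sigma>\<^sub>r_eq by (simp add: mat_adjoint_block_diag)

end

theorem theorem4p2:
  fixes G :: grid and \<alpha> \<beta> :: real and \<mu> \<epsilon> \<xi> \<zeta> :: "complex mat"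
  assumes "n\<^sub>1 G \<ge> 2" and "n\<^sub>2 G \<ge> 2" and "n\<^sub>3 G \<ge> 2"
    and "\<delta>\<^sub>x G > 0" and "\<delta>\<^sub>y G > 0" and "\<delta>\<^sub>z G > 0"
    and "lattice_const G > 0"
    and "wave G \<in> carrier_vec 3" and "wave G \<noteq> 0\<^sub>v 3"
    and "\<And>l. l < 3 \<Longrightarrow> 0 \<le> wave G $ l \<and> wave G $ l \<le> 1 / (2 * lattice_const G)"
    and "\<alpha> \<noteq> 0" and "\<beta> \<noteq> 0"
    and "\<alpha> * \<delta>\<^sub>x G \<noteq> \<beta> * \<delta>\<^sub>y G" and "\<delta>\<^sub>z G \<noteq> \<beta> * \<delta>\<^sub>y G"
    and "\<mu> \<in> carrier_mat (3 * size_grid G) (3 * size_grid G)"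
    and "\<epsilon> \<in> carrier_mat (3 * size_grid G) (3 * size_grid G)"
    and "\<xi> \<in> carrier_mat (3 * size_grid G) (3 * size_grid G)"
    and "\<zeta> \<in> carrier_mat (3 * size_grid G) (3 * size_grid G)"
    and "hermitian \<mu>" and "positive_definite \<mu>"
    and "hermitian (\<Phi>_mat \<mu> \<epsilon> \<xi> \<zeta>)" and "positive_definite (\<Phi>_mat \<mu> \<epsilon> \<xi> \<zeta>)"
    and "mat_adjoint \<xi> = \<zeta>"
  shows "(\<forall>\<omega>::complex. \<omega> \<noteq> 0 \<longrightarrow>
            (gen_eigenvalue (6 * size_grid G) (maxwell_lhs G) (maxwell_rhs \<mu> \<epsilon> \<xi> \<zeta>) \<omega> \<longleftrightarrow>
             gen_eigenvalue (4 * size_grid G) (reduced_lhs G) (A\<^sub>r G \<alpha> \<beta> \<mu> \<epsilon> \<xi> \<zeta>) (inverse \<omega>)))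
       \<and> mat_kernel (reduced_lhs G) = {0\<^sub>v (4 * size_grid G)}
       \<and> hermitian (A\<^sub>r G \<alpha> \<beta> \<mu> \<epsilon> \<xi> \<zeta>)
       \<and> positive_definite (A\<^sub>r G \<alpha> \<beta> \<mu> \<epsilon> \<xi> \<zeta>)"
proof -
  have q: "symbol_sq G k > 0" if "k < size_grid G" for k
    by (rule symbol_sq_pos) (use assms that in auto)
  have p: "cross_sq G \<alpha> \<beta> k > 0" if "k < size_grid G" for k
    by (rule cross_sq_pos[OF q[OF that]]) (use assms in auto)
  note grid = assms(1-3) q p
  have PQ: "P\<^sub>r G \<alpha> \<beta> \<in> carrier_mat (3 * size_grid G) (2 * size_grid G)"
    "Q\<^sub>r G \<alpha> \<beta> \<in> carrier_mat (3 * size_grid G) (2 * size_grid G)"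
    "\<Sigma>\<^sub>r G \<in> carrier_mat (2 * size_grid G) (2 * size_grid G)"
    by (rule carrier_matI; simp add: dim_PQ[OF grid])+
  note red = svd_reduction[OF PQ(1,2,3) \<Sigma>\<^sub>r_inverse(2,1)[OF grid] \<Sigma>\<^sub>r_hermitian[OF grid]
      curl_svd[OF grid]
      singular_vectors_isometry[OF grid] assms(15-20) assms(21,22)[unfolded \<Phi>_mat_def] assms(23)]
  have dims: "3 * size_grid G + 3 * size_grid G = 6 * size_grid G"
      "2 * size_grid G + 2 * size_grid G = 4 * size_grid G"
    by simp_all
  show ?thesis
    unfolding maxwell_lhs_def maxwell_rhs_def reduced_lhs_def A\<^sub>r_def Let_def diag_block_mat_pair
        \<Phi>_mat_def
    using red unfolding dims by blast
qed

end
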